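(* Let $(R,\nu)$ be a discrete valuation ring with residue field $k$ and fraction field $K$, and let $G$ be a finite group. If $p = \operatorname{char}(k) > 0$, assume that $G$ is weakly tame at $p$. Then $$\operatorname{ed}_K(G) \geq \operatorname{ed}_k(G).$$
   Context: A finite group $G$ is weakly tame at a prime $p$ if $G$ contains no non-trivial normal $p$-subgroup. For a field $F$ and a finite group $G$, $\operatorname{ed}_F(G)$ denotes the essential dimension of $G$ over $F$: it is the supremum, over all field extensions $M/F$ and all $G$-torsors $T \to \operatorname{Spec} M$, of the minimum of $\operatorname{trdeg}_F M_0$ over intermediate fields $F \subseteq M_0 \subseteq M$ such that $T$ is isomorphic to the pullback of a $G$-torsor over $\operatorname{Spec} M_0$. Equivalently, if $V$ is the regular representation of $G$ over $F$, then $\operatorname{ed}_F(G)$ is the minimal value of $\operatorname{trdeg}_F(L)$ as $L$ ranges over the $G$-invariant intermediate fields $F \subseteq L \subseteq F(V)$ on which $G$ acts faithfully. *)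

theory Defs
  imports
    "HOL-Algebra.Group_Action"
    "HOL-Algebra.Generated_Fields"
    "HOL-Algebra.Algebraic_Closure_Type"
    "HOL-Library.Poly_Mapping"
    "HOL-Library.Extended_Nat"
    "HOL-Computational_Algebra.Fraction_Field"
begin

section \<open>Discrete valuation rings\<close>

text \<open>The fraction field \<open>K\<close> is the whole type \<open>'a\<close>, and \<open>R\<close> is a subset of it;
  \<open>fraction_field\<close> below checks that \<open>'a\<close> is the fraction field of \<open>R\<close>.
  The conventional value \<open>\<nu> 0 = \<infinity>\<close> is replaced by excluding \<open>0\<close>, so that \<open>\<nu> 0\<close> is
  irrelevant. The valuation is normalized, i.e. its value group is all of the integers.\<close>

locale discrete_valuation_ring =
  fixes R :: "'a::field set" and \<nu> :: "'a \<Rightarrow> int"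
  assumes val_mult: "\<lbrakk>x \<noteq> 0; y \<noteq> 0\<rbrakk> \<Longrightarrow> \<nu> (x * y) = \<nu> x + \<nu> y"
    and val_add: "\<lbrakk>x \<noteq> 0; y \<noteq> 0; x + y \<noteq> 0\<rbrakk> \<Longrightarrow> min (\<nu> x) (\<nu> y) \<le> \<nu> (x + y)"
    and val_onto: "\<exists>x. x \<noteq> 0 \<and> \<nu> x = n"
    and valuation_ring: "R = {x. x = 0 \<or> 0 \<le> \<nu> x}"
begin

definition maximal_ideal :: "'a set" where
  "maximal_ideal = {x. x = 0 \<or> 0 < \<nu> x}"

lemma val_one: "\<nu> 1 = 0"
  using val_mult[of 1 1] by simp

lemma fraction_field: "\<exists>a\<in>R. \<exists>b\<in>R. b \<noteq> 0 \<and> x = a / b"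
proof (cases "x \<in> R")
  case True
  then show ?thesis
    by (intro bexI[of _ x] bexI[of _ 1]) (auto simp: valuation_ring val_one)
next
  case False
  then have "x \<noteq> 0" "\<nu> x < 0" by (auto simp: valuation_ring)
  moreover have "\<nu> x + \<nu> (inverse x) = 0"
    using val_mult[of x "inverse x"] \<open>x \<noteq> 0\<close> by (simp add: val_one)
  ultimately show ?thesis
    by (intro bexI[of _ 1] bexI[of _ "inverse x"])
       (auto simp: valuation_ring val_one divide_inverse)
qed

end

text \<open>The field \<open>'k\<close> together with \<open>\<rho> : R \<rightarrow> 'k\<close> is a residue field of \<open>R\<close>:
  \<open>\<rho>\<close> is a surjective ring homomorphism whose kernel is the maximal ideal. The values of
  \<open>\<rho>\<close> outside \<open>R\<close> are irrelevant.\<close>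

locale dvr_with_residue_field = discrete_valuation_ring R \<nu>
  for R :: "'a::field set" and \<nu> :: "'a \<Rightarrow> int" +
  fixes \<rho> :: "'a \<Rightarrow> 'k::field"
  assumes residue_one: "\<rho> 1 = 1"
    and residue_add: "\<lbrakk>x \<in> R; y \<in> R\<rbrakk> \<Longrightarrow> \<rho> (x + y) = \<rho> x + \<rho> y"
    and residue_mult: "\<lbrakk>x \<in> R; y \<in> R\<rbrakk> \<Longrightarrow> \<rho> (x * y) = \<rho> x * \<rho> y"
    and residue_onto: "\<rho> ` R = UNIV"
    and residue_kernel: "{x \<in> R. \<rho> x = 0} = maximal_ideal"


section \<open>Weakly tame groups\<close>

definition weakly_tame :: "nat \<Rightarrow> ('g, 'm) monoid_scheme \<Rightarrow> bool" where
  "weakly_tame p G \<longleftrightarrow>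
     \<not> (\<exists>N. N \<lhd> G \<and> (\<exists>n. card N = p ^ n) \<and> N \<noteq> {\<one>\<^bsub>G\<^esub>})"


section \<open>Polynomials in several variables and transcendence degree\<close>

text \<open>Polynomials with coefficients in \<open>'f\<close> and variables in \<open>'v\<close> are the elements of
  \<open>('v \<Rightarrow>\<^sub>0 nat) \<Rightarrow>\<^sub>0 'f\<close>. The polynomial \<open>p\<close> is evaluated at the point \<open>x\<close> after
  mapping its coefficients by \<open>h\<close>.\<close>

definition mpoly_eval ::
    "('f::zero \<Rightarrow> 'e::comm_semiring_1) \<Rightarrow> ('v \<Rightarrow> 'e) \<Rightarrow> (('v \<Rightarrow>\<^sub>0 nat) \<Rightarrow>\<^sub>0 'f) \<Rightarrow> 'e" where
  "mpoly_eval h x p =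
     (\<Sum>m\<in>Poly_Mapping.keys p. h (Poly_Mapping.lookup p m) *
        (\<Prod>v\<in>Poly_Mapping.keys m. x v ^ Poly_Mapping.lookup m v))"

definition alg_independent :: "('f::zero \<Rightarrow> 'e::comm_semiring_1) \<Rightarrow> 'e set \<Rightarrow> bool" where
  "alg_independent \<iota> S \<longleftrightarrow>
     (\<forall>p :: ('e \<Rightarrow>\<^sub>0 nat) \<Rightarrow>\<^sub>0 'f.
        (\<forall>m\<in>Poly_Mapping.keys p. Poly_Mapping.keys m \<subseteq> S) \<longrightarrow>
        mpoly_eval \<iota> (\<lambda>s. s) p = 0 \<longrightarrow> p = 0)"

text \<open>Transcendence degree of a field \<open>L\<close> over its subfield \<open>\<iota> ` UNIV\<close>, where
  \<open>\<iota>\<close> is a field embedding.\<close>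

definition trdeg :: "('f::zero \<Rightarrow> 'e::comm_semiring_1) \<Rightarrow> 'e set \<Rightarrow> enat" where
  "trdeg \<iota> L = (SUP S \<in> {S. finite S \<and> S \<subseteq> L \<and> alg_independent \<iota> S}. enat (card S))"

lemma prod_keys_superset:
  fixes x :: "'v \<Rightarrow> 'e::comm_semiring_1"
  assumes "finite A" "Poly_Mapping.keys m \<subseteq> A"
  shows "(\<Prod>v\<in>Poly_Mapping.keys m. x v ^ Poly_Mapping.lookup m v) =
         (\<Prod>v\<in>A. x v ^ Poly_Mapping.lookup m v)"
  using assms by (intro prod.mono_neutral_left) (auto simp: in_keys_iff)

lemma prod_keys_add:
  fixes x :: "'v \<Rightarrow> 'e::comm_semiring_1"
  shows "(\<Prod>v\<in>Poly_Mapping.keys (m + n). x v ^ Poly_Mapping.lookup (m + n) v) =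
    (\<Prod>v\<in>Poly_Mapping.keys m. x v ^ Poly_Mapping.lookup m v) *
    (\<Prod>v\<in>Poly_Mapping.keys n. x v ^ Poly_Mapping.lookup n v)"
proof -
  let ?A = "Poly_Mapping.keys m \<union> Poly_Mapping.keys n"
  have "Poly_Mapping.keys (m + n) \<subseteq> ?A" by (rule Poly_Mapping.keys_add)
  then show ?thesis
    by (subst (1 2 3) prod_keys_superset[where A = ?A])
       (auto simp: lookup_add power_add prod.distrib)
qed

lemma poly_mapping_sum_single:
  "p = (\<Sum>m\<in>Poly_Mapping.keys p. Poly_Mapping.single m (Poly_Mapping.lookup p m))"
  by (rule poly_mapping_eqI)
     (auto simp: lookup_sum lookup_single when_def in_keys_iff)

context
  fixes h :: "'f::comm_semiring_1 \<Rightarrow> 'e::comm_semiring_1" and x :: "'v \<Rightarrow> 'e"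
  assumes h0: "h 0 = 0" and h1: "h 1 = 1"
    and hadd: "\<And>a b. h (a + b) = h a + h b" and hmult: "\<And>a b. h (a * b) = h a * h b"
begin

lemma mpoly_eval_add: "mpoly_eval h x (p + q) = mpoly_eval h x p + mpoly_eval h x q"
  unfolding mpoly_eval_def
  by (rule setsum_keys_plus_distrib) (simp_all add: h0 hadd algebra_simps)

lemma mpoly_eval_zero: "mpoly_eval h x 0 = 0"
  by (simp add: mpoly_eval_def)

lemma mpoly_eval_sum: "mpoly_eval h x (\<Sum>i\<in>A. f i) = (\<Sum>i\<in>A. mpoly_eval h x (f i))"
  by (induction A rule: infinite_finite_induct) (auto simp: mpoly_eval_zero mpoly_eval_add)

lemma mpoly_eval_single:
  "mpoly_eval h x (Poly_Mapping.single m c) =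
     h c * (\<Prod>v\<in>Poly_Mapping.keys m. x v ^ Poly_Mapping.lookup m v)"
  by (simp add: mpoly_eval_def h0)

lemma mpoly_eval_const: "mpoly_eval h x (Poly_Mapping.single 0 c) = h c"
  by (simp add: mpoly_eval_single)

lemma mpoly_eval_one: "mpoly_eval h x 1 = 1"
  using mpoly_eval_const[of 1] by (simp add: h1)

lemma mpoly_eval_var:
  "mpoly_eval h x (Poly_Mapping.single (Poly_Mapping.single v 1) 1) = x v"
  by (simp add: mpoly_eval_single h1)

lemma mpoly_eval_mult: "mpoly_eval h x (p * q) = mpoly_eval h x p * mpoly_eval h x q"
proof -
  let ?s = "\<lambda>p m. Poly_Mapping.single m (Poly_Mapping.lookup p m)"
  have "p * q = (\<Sum>m\<in>Poly_Mapping.keys p. ?s p m) * (\<Sum>n\<in>Poly_Mapping.keys q. ?s q n)"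
    using poly_mapping_sum_single[of p] poly_mapping_sum_single[of q] by metis
  then have "mpoly_eval h x (p * q) =
      (\<Sum>m\<in>Poly_Mapping.keys p. \<Sum>n\<in>Poly_Mapping.keys q.
         mpoly_eval h x (?s p m) * mpoly_eval h x (?s q n))"
    by (simp add: sum_product mpoly_eval_sum mult_single mpoly_eval_single hmult
        prod_keys_add algebra_simps)
  also have "\<dots> = mpoly_eval h x p * mpoly_eval h x q"
    by (simp add: mpoly_eval_single sum_product[symmetric]) (simp add: mpoly_eval_def)
  finally show ?thesis .
qed

lemma mpoly_eval_prod: "mpoly_eval h x (\<Prod>i\<in>A. f i) = (\<Prod>i\<in>A. mpoly_eval h x (f i))"
  by (induction A rule: infinite_finite_induct) (auto simp: mpoly_eval_one mpoly_eval_mult)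

lemma mpoly_eval_power: "mpoly_eval h x (p ^ n) = mpoly_eval h x p ^ n"
  by (induction n) (auto simp: mpoly_eval_one mpoly_eval_mult)

end


section \<open>The rational function field of the regular representation\<close>

text \<open>Variables labelled by \<open>'g\<close>. The library provides the integral domain structure on
  polynomials, hence the field of fractions, only for linearly ordered variables; therefore
  the labels are wrapped into a type that carries some (irrelevant) linear order.\<close>

datatype 'g indet = Indet 'g

instantiation indet :: (type) linorder
begin

definition less_eq_indet :: "'g indet \<Rightarrow> 'g indet \<Rightarrow> bool" where
  "less_eq_indet a b \<longleftrightarrow> (a, b) \<in> (SOME r. Well_order r \<and> Field r = UNIV)"

definition less_indet :: "'g indet \<Rightarrow> 'g indet \<Rightarrow> bool" where
  "less_indet a b \<longleftrightarrow> a \<le> b \<and> a \<noteq> b"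

instance
proof -
  let ?r = "SOME r :: 'a indet rel. Well_order r \<and> Field r = UNIV"
  have "Well_order ?r \<and> Field ?r = UNIV"
    using someI_ex[OF well_ordering[where 'a = "'a indet"]] .
  then have "Linear_order ?r" "Field ?r = UNIV"
    by (auto simp: well_order_on_def)
  then have *: "refl ?r" "trans ?r" "antisym ?r" "total ?r"
    by (auto simp: linear_order_on_def partial_order_on_def preorder_on_def)
  show "OFCLASS('a indet, linorder_class)"
  proof
    fix a b c :: "'a indet"
    show "a \<le> a" using *(1) by (auto simp: less_eq_indet_def refl_on_def)
    show "a \<le> c" if "a \<le> b" "b \<le> c"
      using *(2) that unfolding less_eq_indet_def by (rule transD)
    show antisym: "a = b" if "a \<le> b" "b \<le> a"
      using *(3) that unfolding less_eq_indet_def by (rule antisymD)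
    show "a < b \<longleftrightarrow> a \<le> b \<and> \<not> b \<le> a"
      using antisym \<open>a \<le> a\<close> unfolding less_indet_def by blast
    show "a \<le> b \<or> b \<le> a"
    proof (cases "a = b")
      case True
      then show ?thesis using \<open>a \<le> a\<close> by blast
    next
      case False
      then show ?thesis using *(4) unfolding less_eq_indet_def total_on_def by blast
    qed
  qed
qed

end

type_synonym ('g, 'f) ratfun = "(('g indet \<Rightarrow>\<^sub>0 nat) \<Rightarrow>\<^sub>0 'f) fract"

definition ratfun_const :: "'f::field \<Rightarrow> ('g, 'f) ratfun" where
  "ratfun_const c = Fract (Poly_Mapping.single 0 c) 1"

definition ratfun_var :: "'g \<Rightarrow> ('g, 'f::field) ratfun" where
  "ratfun_var h = Fract (Poly_Mapping.single (Poly_Mapping.single (Indet h) 1) 1) 1"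

text \<open>The function field \<open>F(V) = F(x\<^sub>h : h \<in> G)\<close> of the regular representation \<open>V\<close>.\<close>

definition regular_function_field :: "('g, 'm) monoid_scheme \<Rightarrow> ('g, 'f::field) ratfun set" where
  "regular_function_field G =
     generate_field ring_of_type_algebra (range ratfun_const \<union> ratfun_var ` carrier G)"

definition left_translate :: "('g, 'm) monoid_scheme \<Rightarrow> 'g \<Rightarrow> 'g \<Rightarrow> 'g" where
  "left_translate G g h = (if h \<in> carrier G then g \<otimes>\<^bsub>G\<^esub> h else h)"

definition mpoly_translate ::
    "('g, 'm) monoid_scheme \<Rightarrow> 'g \<Rightarrow> (('g indet \<Rightarrow>\<^sub>0 nat) \<Rightarrow>\<^sub>0 'f) \<Rightarrow>
     (('g indet \<Rightarrow>\<^sub>0 nat) \<Rightarrow>\<^sub>0 'f::field)" where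
  "mpoly_translate G g =
     mpoly_eval (Poly_Mapping.single 0)
       (\<lambda>v. case v of Indet h \<Rightarrow>
          Poly_Mapping.single (Poly_Mapping.single (Indet (left_translate G g h)) 1) 1)"

text \<open>The \<open>F\<close>-automorphism \<open>x\<^sub>h \<mapsto> x\<^bsub>gh\<^esub>\<close> by which \<open>g \<in> G\<close> acts on \<open>F(V)\<close>. The lemmas
  below show that the description is sound and that the result is a field homomorphism with
  the prescribed values.\<close>

definition regular_action ::
    "('g, 'm) monoid_scheme \<Rightarrow> 'g \<Rightarrow> ('g, 'f::field) ratfun \<Rightarrow> ('g, 'f) ratfun" where
  "regular_action G g r =
     (THE s. \<exists>a b. b \<noteq> 0 \<and> r = Fract a b \<and> s = Fract (mpoly_translate G g a) (mpoly_translate G g b))"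

lemma single_0_hom:
  "Poly_Mapping.single 0 (0::'f::field) = (0 :: 'm::monoid_add \<Rightarrow>\<^sub>0 'f)"
  "Poly_Mapping.single 0 (1::'f) = (1 :: 'm \<Rightarrow>\<^sub>0 'f)"
  "Poly_Mapping.single 0 (a + b) = (Poly_Mapping.single 0 a + Poly_Mapping.single 0 b :: 'm \<Rightarrow>\<^sub>0 'f)"
  "Poly_Mapping.single 0 (a * b) = (Poly_Mapping.single 0 a * Poly_Mapping.single 0 b :: 'm \<Rightarrow>\<^sub>0 'f)"
  by (simp_all add: single_add mult_single)

lemma mpoly_translate_hom:
  "mpoly_translate G g 0 = 0"
  "mpoly_translate G g 1 = 1"
  "mpoly_translate G g (p + q) = mpoly_translate G g p + mpoly_translate G g q"
  "mpoly_translate G g (p * q) = mpoly_translate G g p * mpoly_translate G g q"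
  "mpoly_translate G g (Poly_Mapping.single 0 c) = Poly_Mapping.single 0 c"
  "mpoly_translate G g (Poly_Mapping.single (Poly_Mapping.single (Indet h) 1) 1) =
     Poly_Mapping.single (Poly_Mapping.single (Indet (left_translate G g h)) 1) 1"
  unfolding mpoly_translate_def
  by (simp_all add: mpoly_eval_zero mpoly_eval_one mpoly_eval_add mpoly_eval_mult
      mpoly_eval_const mpoly_eval_var single_0_hom del: One_nat_def)

lemma mpoly_var_power:
  "Poly_Mapping.single (Poly_Mapping.single v (1::nat)) (1::'f::field) ^ n =
   Poly_Mapping.single (Poly_Mapping.single v n) 1"
  by (induction n) (auto simp: mult_single single_add[symmetric])

lemma mpoly_eval_id:
  "mpoly_eval (Poly_Mapping.single 0)
     (\<lambda>v. Poly_Mapping.single (Poly_Mapping.single v 1) 1) p = (p :: ('v \<Rightarrow>\<^sub>0 nat) \<Rightarrow>\<^sub>0 'f::field)"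
proof -
  have prod: "(\<Prod>v\<in>A. Poly_Mapping.single (f v) (1::'f)) = Poly_Mapping.single (\<Sum>v\<in>A. f v) 1"
    for A :: "'v set" and f :: "'v \<Rightarrow> 'v \<Rightarrow>\<^sub>0 nat"
    by (induction A rule: infinite_finite_induct) (auto simp: mult_single)
  show ?thesis
    by (simp add: mpoly_eval_def mpoly_var_power prod mult_single
        poly_mapping_sum_single[symmetric] del: One_nat_def)
qed

lemma mpoly_translate_mult:
  fixes p :: "('g indet \<Rightarrow>\<^sub>0 nat) \<Rightarrow>\<^sub>0 'f::field"
  assumes "group G" "g \<in> carrier G" "g' \<in> carrier G"
  shows "mpoly_translate G g (mpoly_translate G g' p) = mpoly_translate G (g \<otimes>\<^bsub>G\<^esub> g') p"
proof -
  interpret group G by fact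
  let ?X = "\<lambda>h. Poly_Mapping.single (Poly_Mapping.single (Indet h) (1::nat)) (1::'f)"
  have lt: "left_translate G g (left_translate G g' h) = left_translate G (g \<otimes>\<^bsub>G\<^esub> g') h" for h
    using assms by (auto simp: left_translate_def m_assoc)
  have sum: "mpoly_translate G g (\<Sum>i\<in>A. f i) = (\<Sum>i\<in>A. mpoly_translate G g (f i))"
    for A :: "('g indet \<Rightarrow>\<^sub>0 nat) set" and f :: "_ \<Rightarrow> ('g indet \<Rightarrow>\<^sub>0 nat) \<Rightarrow>\<^sub>0 'f"
    unfolding mpoly_translate_def by (rule mpoly_eval_sum) (simp_all add: single_0_hom)
  have prod: "mpoly_translate G g (\<Prod>i\<in>A. f i) = (\<Prod>i\<in>A. mpoly_translate G g (f i))"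
    for A :: "'g indet set" and f :: "_ \<Rightarrow> ('g indet \<Rightarrow>\<^sub>0 nat) \<Rightarrow>\<^sub>0 'f"
    unfolding mpoly_translate_def by (rule mpoly_eval_prod) (simp_all add: single_0_hom)
  have pow: "mpoly_translate G g (f ^ n) = mpoly_translate G g f ^ n"
    for f :: "('g indet \<Rightarrow>\<^sub>0 nat) \<Rightarrow>\<^sub>0 'f" and n
    unfolding mpoly_translate_def by (rule mpoly_eval_power) (simp_all add: single_0_hom)
  have case_eq: "mpoly_translate G g (case v of Indet h \<Rightarrow> ?X (left_translate G g' h)) =
      (case v of Indet h \<Rightarrow> ?X (left_translate G (g \<otimes>\<^bsub>G\<^esub> g') h))" for v
    by (cases v) (simp add: mpoly_translate_hom(6) lt del: One_nat_def)
  have "mpoly_translate G g (mpoly_translate G g' p) =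
      mpoly_translate G g (\<Sum>m\<in>Poly_Mapping.keys p. Poly_Mapping.single 0 (Poly_Mapping.lookup p m) *
        (\<Prod>v\<in>Poly_Mapping.keys m. (case v of Indet h \<Rightarrow> ?X (left_translate G g' h)) ^ Poly_Mapping.lookup m v))"
    by (simp only: mpoly_translate_def[of G g'] mpoly_eval_def)
  also have "\<dots> = (\<Sum>m\<in>Poly_Mapping.keys p. Poly_Mapping.single 0 (Poly_Mapping.lookup p m) *
        (\<Prod>v\<in>Poly_Mapping.keys m. (case v of Indet h \<Rightarrow> ?X (left_translate G (g \<otimes>\<^bsub>G\<^esub> g') h)) ^ Poly_Mapping.lookup m v))"
    by (simp only: sum prod pow mpoly_translate_hom case_eq)
  finally show ?thesis by (simp only: mpoly_translate_def mpoly_eval_def)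
qed

lemma mpoly_translate_one:
  fixes p :: "('g indet \<Rightarrow>\<^sub>0 nat) \<Rightarrow>\<^sub>0 'f::field"
  assumes "group G"
  shows "mpoly_translate G \<one>\<^bsub>G\<^esub> p = p"
proof -
  interpret group G by fact
  have "(\<lambda>v. case v of Indet h \<Rightarrow> Poly_Mapping.single
          (Poly_Mapping.single (Indet (left_translate G \<one>\<^bsub>G\<^esub> h)) (1::nat)) (1::'f)) =
        (\<lambda>v. Poly_Mapping.single (Poly_Mapping.single v 1) 1)"
    by (auto simp: fun_eq_iff left_translate_def split: indet.split)
  then show ?thesis by (simp only: mpoly_translate_def mpoly_eval_id)
qed

lemma mpoly_translate_eq_0_iff:
  assumes "group G" "g \<in> carrier G"
  shows "mpoly_translate G g p = 0 \<longleftrightarrow> p = 0"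
proof
  interpret group G by fact
  assume "mpoly_translate G g p = 0"
  then have "mpoly_translate G (inv\<^bsub>G\<^esub> g) (mpoly_translate G g p) = 0"
    by (simp add: mpoly_translate_hom)
  then show "p = 0" using assms by (simp add: mpoly_translate_mult mpoly_translate_one)
qed (simp add: mpoly_translate_hom)

lemma regular_action_Fract:
  fixes a b :: "('g indet \<Rightarrow>\<^sub>0 nat) \<Rightarrow>\<^sub>0 'f::field"
  assumes "group G" "g \<in> carrier G" "b \<noteq> 0"
  shows "regular_action G g (Fract a b) = Fract (mpoly_translate G g a) (mpoly_translate G g b)"
proof -
  let ?t = "mpoly_translate G g"
  have nz: "?t c \<noteq> 0" if "c \<noteq> 0" for c :: "('g indet \<Rightarrow>\<^sub>0 nat) \<Rightarrow>\<^sub>0 'f"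
    using mpoly_translate_eq_0_iff[OF assms(1,2)] that by blast
  have eq: "Fract (?t a') (?t b') = Fract (?t a) (?t b)"
    if "b' \<noteq> 0" "Fract a b = Fract a' b'" for a' b'
  proof -
    have "a * b' = a' * b" using eq_fract(1)[OF assms(3) that(1)] that(2) by blast
    then have "?t (a * b') = ?t (a' * b)" by (rule arg_cong)
    then have "?t a' * ?t b = ?t a * ?t b'"
      unfolding mpoly_translate_hom(4) by (rule sym)
    then show ?thesis
      using eq_fract(1)[OF nz[OF that(1)] nz[OF assms(3)]] by blast
  qed
  show ?thesis
    unfolding regular_action_def
  proof (rule the_equality)
    show "\<exists>a' b'. b' \<noteq> 0 \<and> Fract a b = Fract a' b' \<and> Fract (?t a) (?t b) = Fract (?t a') (?t b')"
      by (intro exI conjI, rule assms(3), rule refl, rule refl)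
  next
    fix r
    assume "\<exists>a' b'. b' \<noteq> 0 \<and> Fract a b = Fract a' b' \<and> r = Fract (?t a') (?t b')"
    then obtain a' b' where "b' \<noteq> 0" "Fract a b = Fract a' b'" and r: "r = Fract (?t a') (?t b')"
      by blast
    from eq[OF this(1,2)] show "r = Fract (?t a) (?t b)" unfolding r .
  qed
qed

lemma regular_action_hom:
  fixes r s :: "('g, 'f::field) ratfun"
  assumes "group G" "g \<in> carrier G"
  shows "regular_action G g (r + s) = regular_action G g r + regular_action G g s"
    and "regular_action G g (r * s) = regular_action G g r * regular_action G g s"
    and "regular_action G g (ratfun_const c :: ('g, 'f) ratfun) = ratfun_const c"
    and "regular_action G g (ratfun_var h :: ('g, 'f) ratfun) = ratfun_var (left_translate G g h)"
proof -
  note * = regular_action_Fract[OF assms] mpoly_translate_hom(3,4)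
    mpoly_translate_eq_0_iff[OF assms]
  obtain a b where r: "r = Fract a b" "b \<noteq> 0" by (rule Fract_cases)
  obtain c d where s: "s = Fract c d" "d \<noteq> 0" by (rule Fract_cases)
  show "regular_action G g (r + s) = regular_action G g r + regular_action G g s"
    using r s by (simp add: *)
  show "regular_action G g (r * s) = regular_action G g r * regular_action G g s"
    using r s by (simp add: *)
qed (simp_all add: ratfun_const_def ratfun_var_def regular_action_Fract[OF assms]
      mpoly_translate_hom(2,5,6) del: One_nat_def)

lemma regular_action_mult:
  assumes "group G" "g \<in> carrier G" "g' \<in> carrier G"
  shows "regular_action G g (regular_action G g' r) = regular_action G (g \<otimes>\<^bsub>G\<^esub> g') r"
    and "regular_action G \<one>\<^bsub>G\<^esub> r = r"
proof -
  interpret group G by fact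
  obtain a b where r: "r = Fract a b" and b: "b \<noteq> 0" by (rule Fract_cases)
  have b': "mpoly_translate G g' b \<noteq> 0"
    using b mpoly_translate_eq_0_iff[OF assms(1,3)] by blast
  show "regular_action G g (regular_action G g' r) = regular_action G (g \<otimes>\<^bsub>G\<^esub> g') r"
    unfolding r regular_action_Fract[OF assms(1,3) b] regular_action_Fract[OF assms(1,2) b']
      regular_action_Fract[OF assms(1) m_closed[OF assms(2,3)] b] mpoly_translate_mult[OF assms] ..
  show "regular_action G \<one>\<^bsub>G\<^esub> r = r"
    unfolding r regular_action_Fract[OF assms(1) one_closed b] mpoly_translate_one[OF assms(1)] ..
qed


section \<open>Essential dimension\<close>

text \<open>The intermediate fields \<open>F \<subseteq> L \<subseteq> F(V)\<close> that are invariant under \<open>G\<close> and on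
  which \<open>G\<close> acts faithfully.\<close>

definition faithful_intermediate_fields ::
    "('g, 'm) monoid_scheme \<Rightarrow> ('g, 'f::field) ratfun set set" where
  "faithful_intermediate_fields G =
     {L. subfield L ring_of_type_algebra \<and>
         range ratfun_const \<subseteq> L \<and> L \<subseteq> regular_function_field G \<and>
         (\<forall>g\<in>carrier G. regular_action G g ` L \<subseteq> L) \<and>
         faithful_action G L (\<lambda>g. restrict (regular_action G g) L)}"

text \<open>The first argument only names the ground field \<open>'f\<close>. As \<open>enat\<close> is well-ordered, the
  infimum is a minimum.\<close>

definition essential_dimension ::
    "'f::field itself \<Rightarrow> ('g, 'm) monoid_scheme \<Rightarrow> enat" where
  "essential_dimension _ G =
     (INF L \<in> (faithful_intermediate_fields G :: ('g, 'f) ratfun set set).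
        trdeg (ratfun_const :: 'f \<Rightarrow> ('g, 'f) ratfun) L)"

end

theory Submission
  imports Defs "HOL-Algebra.Sylow"
begin

text \<open>
  The idea is to specialize a field on which \<open>G\<close> acts from \<open>K\<close> to \<open>k\<close>. Extend \<open>\<nu>\<close> to the
  Gauss valuation on \<open>K(V)\<close>, whose value on a polynomial is the least valuation of a coefficient.
  Its residue field is \<open>k(V)\<close>, and since \<open>G\<close> permutes the variables, the residue map is
  \<open>G\<close>-equivariant. A faithful \<open>G\<close>-invariant field \<open>L\<close> between \<open>K\<close> and \<open>K(V)\<close> thus
  has a \<open>G\<close>-invariant residue field \<open>\<ell>\<close> between \<open>k\<close> and \<open>k(V)\<close>. It suffices to show that
  \<open>trdeg \<ell> \<le> trdeg L\<close> and that \<open>G\<close> acts faithfully on \<open>\<ell>\<close>.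

  The inequality holds because lifts of algebraically independent residues are algebraically
  independent (\<open>trdeg_residue_field_le\<close>).

  For faithfulness, let \<open>N\<close> be the kernel of the action on \<open>\<ell>\<close>, that is, the inertia group.
  The Gauss valuation has the same value group as \<open>\<nu>\<close>, so every nonzero element of \<open>L\<close> is a
  \<open>G\<close>-invariant constant times a unit (\<open>unit_multiple_exists\<close>). If \<open>g \<in> N\<close> has prime order
  \<open>q\<close>, then \<open>g x \<noteq> x\<close> for some \<open>x \<in> L\<close>; write \<open>g x - x = c u\<close> with \<open>c\<close> constant and
  \<open>u\<close> a unit with residue \<open>s\<close>. The sum of the conjugates \<open>g\<^sup>j u\<close> over \<open>j < q\<close> telescopes to
  zero, but its residue is \<open>q s\<close>; hence \<open>q = char k\<close>
  (\<open>char_eq_order_of_inertia_element\<close>). So \<open>N\<close> is a normal subgroup of \<open>G\<close> which is trivial in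
  characteristic zero and a \<open>p\<close>-group in characteristic \<open>p\<close>; in the latter case weak tameness
  makes it trivial as well (\<open>residue_field_faithful\<close>).
\<close>


section \<open>Finite groups and subfields\<close>

text \<open>Cauchy's theorem: a subgroup of order \<open>q\<close>, given by Sylow's theorem, is not trivial,
  and the \<open>q\<close>-th power of each of its elements is the identity.\<close>

lemma exists_element_of_prime_order:
  assumes "group G" "finite (carrier G)" "prime q" "q dvd card (carrier G)"
  shows "\<exists>x\<in>carrier G. x \<noteq> \<one>\<^bsub>G\<^esub> \<and> x [^]\<^bsub>G\<^esub> q = \<one>\<^bsub>G\<^esub>"
proof -
  interpret group G by fact
  obtain m where "Coset.order G = q ^ 1 * m"
    using assms(4) by (auto simp: Coset.order_def)
  then obtain H where H: "subgroup H G" "card H = q"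
    using sylow_thm[OF assms(3,1) _ assms(2), of 1 m] by auto
  then have "\<not> H \<subseteq> {\<one>\<^bsub>G\<^esub>}"
    using prime_gt_1_nat[OF assms(3)] card_mono[of "{\<one>\<^bsub>G\<^esub>}" H] by auto
  then obtain x where x: "x \<in> H" "x \<noteq> \<one>\<^bsub>G\<^esub>"
    by blast
  interpret H: group "G\<lparr>carrier := H\<rparr>"
    using H(1) assms(1) by (rule subgroup.subgroup_is_group)
  have "x [^]\<^bsub>G\<lparr>carrier := H\<rparr>\<^esub> q = \<one>\<^bsub>G\<^esub>"
    using H.pow_order_eq_1[of x] x(1) H(2) by (simp add: Coset.order_def)
  then show ?thesis
    using x subgroup.mem_carrier[OF H(1)] by (auto simp: nat_pow_consistent[symmetric])
qed

lemma eq_power_if_unique_prime_divisor: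
  fixes n p :: nat
  assumes "n > 0" "prime p" "\<And>q. prime q \<Longrightarrow> q dvd n \<Longrightarrow> q = p"
  shows "\<exists>k. n = p ^ k"
proof -
  obtain m where m: "n = p ^ multiplicity p n * m" "\<not> p dvd m"
    using assms(1,2) multiplicity_decompose'[of n p] by (metis not_gr0 not_prime_unit)
  have "m = 1"
  proof (rule ccontr)
    assume "m \<noteq> 1"
    then obtain q where "prime q" "q dvd m"
      using prime_factor_nat by blast
    then show False
      using assms(3)[of q] m by (metis dvd_mult)
  qed
  then show ?thesis
    using m(1) by auto
qed

lemma field_of_type: "field (ring_of_type_algebra :: 'a::field ring)"
  by (rule field_from_type_algebra)

lemma ring_of_type_simps:
  "carrier ring_of_type_algebra = (UNIV :: 'a::field set)"
  "x \<otimes>\<^bsub>ring_of_type_algebra\<^esub> y = (x * y :: 'a)"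
  "x \<oplus>\<^bsub>ring_of_type_algebra\<^esub> y = (x + y :: 'a)"
  "\<one>\<^bsub>ring_of_type_algebra\<^esub> = (1 :: 'a)"
  "\<zero>\<^bsub>ring_of_type_algebra\<^esub> = (0 :: 'a)"
  by (simp_all add: ring_of_type_algebra_def)

lemma ring_of_type_a_inv: "\<ominus>\<^bsub>ring_of_type_algebra\<^esub> x = (- x :: 'a::field)"
proof -
  interpret field "ring_of_type_algebra :: 'a ring" by (rule field_of_type)
  show ?thesis
    using minus_equality[of "- x" x] by (simp add: ring_of_type_simps)
qed

lemma ring_of_type_m_inv:
  assumes "x \<noteq> 0"
  shows "inv\<^bsub>ring_of_type_algebra\<^esub> x = (inverse x :: 'a::field)"
proof -
  interpret field "ring_of_type_algebra :: 'a ring" by (rule field_of_type)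
  show ?thesis
    using inv_unique'[of x "inverse x"] assms by (simp add: ring_of_type_simps)
qed

lemmas ring_of_type = ring_of_type_simps ring_of_type_a_inv ring_of_type_m_inv

text \<open>Translates membership in a subfield of the record structure into the operations of the
  type class, so that closure properties can be used without carriers.\<close>

lemma subfield_of_type_iff:
  fixes L :: "'a::field set"
  shows "subfield L ring_of_type_algebra \<longleftrightarrow>
    1 \<in> L \<and> (\<forall>x\<in>L. - x \<in> L) \<and> (\<forall>x\<in>L. \<forall>y\<in>L. x + y \<in> L) \<and> (\<forall>x\<in>L. \<forall>y\<in>L. x * y \<in> L) \<and>
    (\<forall>x\<in>L. x \<noteq> 0 \<longrightarrow> inverse x \<in> L)" (is "?l \<longleftrightarrow> ?r")
proof -
  interpret field "ring_of_type_algebra :: 'a ring" by (rule field_of_type)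
  show ?thesis
  proof
    assume L: ?l
    note s = subringE[OF subfieldE(1)[OF L]]
    show ?r
      using s(3,5-7) subfield_m_inv(1)[OF L] by (auto simp: ring_of_type)
  next
    assume ?r
    then show ?l
      by (intro subfieldI' subringI) (auto simp: ring_of_type)
  qed
qed

lemma subfield_generate_field:
  "subfield (generate_field ring_of_type_algebra H) (ring_of_type_algebra :: 'a::field ring)"
  using field.generate_field_is_subfield[OF field_of_type, of H] by (simp add: ring_of_type)

lemma subfield_sum_mem:
  fixes L :: "'a::field set"
  assumes "subfield L ring_of_type_algebra" "\<And>i. i \<in> A \<Longrightarrow> f i \<in> L"
  shows "(\<Sum>i\<in>A. f i) \<in> L"
proof -
  have "0 \<in> L"
    using subringE(2)[OF subfieldE(1)[OF assms(1)]] by (simp add: ring_of_type)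
  then show ?thesis
    using assms by (induction A rule: infinite_finite_induct) (auto simp: subfield_of_type_iff)
qed

lemma subfield_prod_mem:
  fixes L :: "'a::field set"
  assumes "subfield L ring_of_type_algebra" "\<And>i. i \<in> A \<Longrightarrow> f i \<in> L"
  shows "(\<Prod>i\<in>A. f i) \<in> L"
  using assms by (induction A rule: infinite_finite_induct) (auto simp: subfield_of_type_iff)

lemma subfield_power_mem:
  fixes L :: "'a::field set"
  assumes "subfield L ring_of_type_algebra" "x \<in> L"
  shows "x ^ n \<in> L"
  using assms by (induction n) (auto simp: subfield_of_type_iff)


section \<open>Constants and the action on rational functions\<close>

lemma ratfun_const_hom:
  "ratfun_const (0::'f::field) = (0 :: ('g, 'f) ratfun)"
  "ratfun_const (1::'f::field) = (1 :: ('g, 'f) ratfun)"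
  "ratfun_const (a + b) = (ratfun_const a + ratfun_const b :: ('g, 'f) ratfun)"
  "ratfun_const (a * b) = (ratfun_const a * ratfun_const b :: ('g, 'f) ratfun)"
  by (simp_all add: ratfun_const_def single_0_hom fract_collapse)

lemma ratfun_const_eq_0_iff: "(ratfun_const c :: ('g, 'f::field) ratfun) = 0 \<longleftrightarrow> c = 0"
  by (simp add: ratfun_const_def Zero_fract_def eq_fract single_zero)
     (metis lookup_single_eq lookup_zero single_zero)

lemma ratfun_const_of_nat: "(ratfun_const (of_nat n) :: ('g, 'f::field) ratfun) = of_nat n"
  by (induction n) (simp_all add: ratfun_const_hom)

lemma ratfun_const_inverse:
  "(ratfun_const (inverse c) :: ('g, 'f::field) ratfun) = inverse (ratfun_const c)"
proof (cases "c = 0")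
  case False
  then have "(ratfun_const c * ratfun_const (inverse c) :: ('g, 'f) ratfun) = 1"
    by (simp add: ratfun_const_hom(2,4)[symmetric])
  then show ?thesis
    by (rule inverse_unique[symmetric])
qed (simp add: ratfun_const_hom)

lemma regular_action_zero:
  assumes "group G" "g \<in> carrier G"
  shows "regular_action G g 0 = 0"
  using regular_action_hom(3)[OF assms, of 0] by (simp add: ratfun_const_hom)

lemma regular_action_minus:
  assumes "group G" "g \<in> carrier G"
  shows "regular_action G g (- r) = - regular_action G g r"
proof -
  have "regular_action G g (- r) + regular_action G g r = 0"
    using regular_action_hom(1)[OF assms, of "- r" r] regular_action_zero[OF assms]
    by (metis add.left_inverse)
  then show ?thesis
    by (simp add: eq_neg_iff_add_eq_0)
qed

lemma regular_action_diff:
  assumes "group G" "g \<in> carrier G"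
  shows "regular_action G g (r - s) = regular_action G g r - regular_action G g s"
  using regular_action_hom(1)[OF assms, of r "- s"] regular_action_minus[OF assms] by simp

lemma regular_action_restrict_hom:
  fixes L :: "('g, 'f::field) ratfun set" and G :: "('g, 'm) monoid_scheme"
  assumes "group G" "\<And>g. g \<in> carrier G \<Longrightarrow> regular_action G g ` L \<subseteq> L"
  shows "group_hom G (BijGroup L) (\<lambda>g. restrict (regular_action G g) L)"
proof -
  interpret group G by fact
  have inv: "regular_action G g (regular_action G (inv\<^bsub>G\<^esub> g) x) = x"
       "regular_action G (inv\<^bsub>G\<^esub> g) (regular_action G g x) = x"
    if "g \<in> carrier G" for g and x :: "('g, 'f) ratfun"
    using that by (simp_all add: regular_action_mult[OF assms(1)])
  have bij: "restrict (regular_action G g) L \<in> Bij L" if g: "g \<in> carrier G" for g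
  proof -
    have "bij_betw (regular_action G g) L L"
      by (rule bij_betwI[where g = "regular_action G (inv\<^bsub>G\<^esub> g)"])
         (use g assms(2) inv in auto)
    then show ?thesis
      by (simp add: Bij_def)
  qed
  show ?thesis
  proof (intro group_hom.intro group_hom_axioms.intro homI)
    show "group (BijGroup L)" by (rule group_BijGroup)
  next
    fix g h assume gh: "g \<in> carrier G" "h \<in> carrier G"
    show "restrict (regular_action G (g \<otimes>\<^bsub>G\<^esub> h)) L =
      restrict (regular_action G g) L \<otimes>\<^bsub>BijGroup L\<^esub> restrict (regular_action G h) L"
      using gh bij[OF gh(1)] bij[OF gh(2)] assms(2)[OF gh(2)]
      by (auto simp: BijGroup_def compose_def fun_eq_iff regular_action_mult[OF assms(1)])
  qed (use assms bij in \<open>auto simp: BijGroup_def\<close>)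
qed

text \<open>The kernel is what matters about the action on \<open>L\<close>: it is normal, being the kernel of
  a homomorphism, and its triviality is faithfulness.\<close>

lemma kernel_restricted_regular_action:
  fixes L :: "('g, 'f::field) ratfun set"
  shows "kernel G (BijGroup L) (\<lambda>g. restrict (regular_action G g) L) =
    {g \<in> carrier G. \<forall>x\<in>L. regular_action G g x = x}"
  by (auto simp: kernel_def BijGroup_def fun_eq_iff restrict_def)

lemma faithful_restricted_regular_action_iff:
  fixes L :: "('g, 'f::field) ratfun set"
  assumes "group G" "\<And>g. g \<in> carrier G \<Longrightarrow> regular_action G g ` L \<subseteq> L"
  shows "faithful_action G L (\<lambda>g. restrict (regular_action G g) L) \<longleftrightarrow>
    {g \<in> carrier G. \<forall>x\<in>L. regular_action G g x = x} = {\<one>\<^bsub>G\<^esub>}"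
proof -
  interpret group_hom G "BijGroup L" "\<lambda>g. restrict (regular_action G g) L"
    using assms by (rule regular_action_restrict_hom)
  have "group_action G L (\<lambda>g. restrict (regular_action G g) L)"
    by (rule group_action.intro) (rule group_hom_axioms)
  then show ?thesis
    using inj_iff_trivial_ker
    by (simp add: faithful_action_def faithful_action_axioms_def kernel_restricted_regular_action)
qed

text \<open>Translation permutes monomials and keeps coefficients. As the permutation of the
  monomials does not depend on the coefficient field, translation commutes with any operation
  performed on coefficients, in particular with reduction.\<close>

lemma mpoly_translate_expand:
  fixes p :: "('g indet \<Rightarrow>\<^sub>0 nat) \<Rightarrow>\<^sub>0 'f::field"
  shows "mpoly_translate G g p = (\<Sum>m\<in>Poly_Mapping.keys p.
    Poly_Mapping.single (\<Sum>v\<in>Poly_Mapping.keys m. Poly_Mapping.single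
      (case v of Indet h \<Rightarrow> Indet (left_translate G g h)) (Poly_Mapping.lookup m v))
      (Poly_Mapping.lookup p m))"
proof -
  have prod: "(\<Prod>v\<in>A. Poly_Mapping.single (f v) (1::'f)) = Poly_Mapping.single (\<Sum>v\<in>A. f v) 1"
    for A :: "'g indet set" and f :: "'g indet \<Rightarrow> 'g indet \<Rightarrow>\<^sub>0 nat"
    by (induction A rule: infinite_finite_induct) (auto simp: mult_single)
  have var: "(case v of Indet h \<Rightarrow>
        Poly_Mapping.single (Poly_Mapping.single (Indet (left_translate G g h)) (1::nat)) (1::'f)) =
      Poly_Mapping.single (Poly_Mapping.single
        (case v of Indet h \<Rightarrow> Indet (left_translate G g h)) 1) 1" for v
    by (cases v) simp
  show ?thesis
    by (simp add: mpoly_translate_def mpoly_eval_def var mpoly_var_power prod mult_single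
        del: One_nat_def)
qed


section \<open>Elements of the function field as quotients of polynomials\<close>

lemma subfield_regular_function_field:
  "subfield (regular_function_field G :: ('g, 'f::field) ratfun set) ring_of_type_algebra"
  unfolding regular_function_field_def by (rule subfield_generate_field)

lemma const_in_regular_function_field: "ratfun_const c \<in> regular_function_field G"
  unfolding regular_function_field_def by (rule generate_field.incl) simp

text \<open>Generated subfields are defined inductively, but reduction is computed on numerators and
  denominators. Hence an explicit form of the elements of \<open>F(V)\<close> is needed in which
  the polynomials involve only the variables labelled by elements of \<open>G\<close>.\<close>

definition polys_in :: "'v set \<Rightarrow> (('v \<Rightarrow>\<^sub>0 nat) \<Rightarrow>\<^sub>0 'f::comm_semiring_1) set" where
  "polys_in A = {p. \<forall>m\<in>Poly_Mapping.keys p. Poly_Mapping.keys m \<subseteq> A}"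

lemma polys_in_add: "p + q \<in> polys_in A" if "p \<in> polys_in A" "q \<in> polys_in A"
  using that Poly_Mapping.keys_add[of p q] unfolding polys_in_def by blast

lemma polys_in_mult: "p * q \<in> polys_in A" if "p \<in> polys_in A" "q \<in> polys_in A"
proof -
  have "Poly_Mapping.keys m \<subseteq> A" if m: "m \<in> Poly_Mapping.keys (p * q)" for m
  proof -
    obtain x y where "m = x + y" "x \<in> Poly_Mapping.keys p" "y \<in> Poly_Mapping.keys q"
      using m keys_mult[of p q] by blast
    then show ?thesis
      using \<open>p \<in> polys_in A\<close> \<open>q \<in> polys_in A\<close> Poly_Mapping.keys_add[of x y]
      unfolding polys_in_def by blast
  qed
  then show ?thesis
    unfolding polys_in_def by blast
qed

lemma Fract_poly_in_regular_function_field: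
  assumes "p \<in> polys_in (Indet ` carrier G)"
  shows "Fract p 1 \<in> (regular_function_field G :: ('g, 'f::field) ratfun set)"
proof -
  let ?F = "regular_function_field G :: ('g, 'f) ratfun set"
  note F = subfield_regular_function_field[of G, where 'f = 'f]
  have add: "Fract (a + b) 1 = Fract a 1 + Fract b 1"
    and mult: "Fract (a * b) 1 = Fract a 1 * Fract b 1"
    for a b :: "('g indet \<Rightarrow>\<^sub>0 nat) \<Rightarrow>\<^sub>0 'f"
    by simp_all
  have sum: "Fract (\<Sum>i\<in>A. f i) 1 = (\<Sum>i\<in>A. Fract (f i) 1)"
    for A :: "('g indet \<Rightarrow>\<^sub>0 nat) set" and f :: "_ \<Rightarrow> ('g indet \<Rightarrow>\<^sub>0 nat) \<Rightarrow>\<^sub>0 'f"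
    by (induction A rule: infinite_finite_induct)
       (simp_all add: fract_collapse add del: add_fract mult_fract)
  have prod: "Fract (\<Prod>i\<in>A. f i) 1 = (\<Prod>i\<in>A. Fract (f i) 1)"
    for A :: "'g indet set" and f :: "_ \<Rightarrow> ('g indet \<Rightarrow>\<^sub>0 nat) \<Rightarrow>\<^sub>0 'f"
    by (induction A rule: infinite_finite_induct)
       (simp_all add: fract_collapse mult del: add_fract mult_fract)
  have pow: "Fract (f ^ n) 1 = Fract f 1 ^ n" for f :: "('g indet \<Rightarrow>\<^sub>0 nat) \<Rightarrow>\<^sub>0 'f" and n
    by (induction n) (simp_all add: fract_collapse mult del: add_fract mult_fract)
  let ?X = "\<lambda>v. Poly_Mapping.single (Poly_Mapping.single v (1::nat)) (1::'f)"
  have "p = mpoly_eval (Poly_Mapping.single 0) ?X p"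
    by (rule mpoly_eval_id[symmetric])
  then have "Fract p 1 = Fract (mpoly_eval (Poly_Mapping.single 0) ?X p) 1"
    by (rule arg_cong)
  also have "\<dots> = (\<Sum>m\<in>Poly_Mapping.keys p. ratfun_const (Poly_Mapping.lookup p m) *
      (\<Prod>v\<in>Poly_Mapping.keys m. Fract (?X v) 1 ^ Poly_Mapping.lookup m v))"
    by (simp only: mpoly_eval_def sum mult prod pow ratfun_const_def)
  also have "\<dots> \<in> ?F"
  proof (rule subfield_sum_mem[OF F])
    fix m assume m: "m \<in> Poly_Mapping.keys p"
    have "Fract (?X v) 1 \<in> ?F" if v: "v \<in> Poly_Mapping.keys m" for v
    proof -
      obtain h where "v = Indet h" "h \<in> carrier G"
        using v m assms unfolding polys_in_def by blast
      then show ?thesis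
        unfolding regular_function_field_def
        by (intro generate_field.incl) (auto simp: ratfun_var_def)
    qed
    then have "(\<Prod>v\<in>Poly_Mapping.keys m. Fract (?X v) 1 ^ Poly_Mapping.lookup m v) \<in> ?F"
      by (intro subfield_prod_mem[OF F] subfield_power_mem[OF F])
    then show "ratfun_const (Poly_Mapping.lookup p m) *
        (\<Prod>v\<in>Poly_Mapping.keys m. Fract (?X v) 1 ^ Poly_Mapping.lookup m v) \<in> ?F"
      using F const_in_regular_function_field unfolding subfield_of_type_iff by blast
  qed
  finally show ?thesis .
qed

lemma Fract_in_regular_function_field:
  assumes "p \<in> polys_in (Indet ` carrier G)" "q \<in> polys_in (Indet ` carrier G)" "q \<noteq> 0"
  shows "Fract p q \<in> (regular_function_field G :: ('g, 'f::field) ratfun set)"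
proof -
  note F = subfield_regular_function_field[of G, where 'f = 'f]
  have "Fract q 1 \<noteq> 0"
    using assms(3) by (simp add: Zero_fract_def eq_fract)
  then have "Fract p 1 * inverse (Fract q 1) \<in> (regular_function_field G :: ('g, 'f) ratfun set)"
    using F Fract_poly_in_regular_function_field[OF assms(1)]
      Fract_poly_in_regular_function_field[OF assms(2)] unfolding subfield_of_type_iff by blast
  then show ?thesis
    by simp
qed

lemma regular_function_fieldE:
  fixes r :: "('g, 'f::field) ratfun"
  assumes "r \<in> regular_function_field G"
  obtains p q where "p \<in> polys_in (Indet ` carrier G)" "q \<in> polys_in (Indet ` carrier G)"
    "q \<noteq> 0" "r = Fract p q"
proof -
  let ?P = "polys_in (Indet ` carrier G) :: (('g indet \<Rightarrow>\<^sub>0 nat) \<Rightarrow>\<^sub>0 'f) set"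
  have one: "1 \<in> ?P" and const: "Poly_Mapping.single 0 c \<in> ?P" for c
    by (auto simp: polys_in_def)
  have poly: "\<exists>p' q. p' \<in> ?P \<and> q \<in> ?P \<and> q \<noteq> 0 \<and> Fract p 1 = Fract p' q" if "p \<in> ?P" for p
    using that one zero_neq_one by metis
  have "\<exists>p q. p \<in> ?P \<and> q \<in> ?P \<and> q \<noteq> 0 \<and> r = Fract p q"
    using assms unfolding regular_function_field_def
  proof (induction r rule: generate_field.induct)
    case one
    show ?case
      unfolding ring_of_type One_fract_def by (rule poly[OF \<open>1 \<in> ?P\<close>])
  next
    case (incl h)
    then consider c where "h = ratfun_const c" | g where "g \<in> carrier G" "h = ratfun_var g"
      by blast
    then show ?case
    proof cases
      case 1
      then show ?thesis
        unfolding 1 ratfun_const_def by (intro poly const)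
    next
      case 2
      then have "Poly_Mapping.single (Poly_Mapping.single (Indet g) 1) 1 \<in> ?P"
        by (auto simp: polys_in_def)
      then show ?thesis
        unfolding 2(2) ratfun_var_def by (rule poly)
    qed
  next
    case (a_inv h)
    then obtain p q where "p \<in> ?P" "q \<in> ?P" "q \<noteq> 0" "h = Fract p q" by blast
    then show ?case
      by (intro exI[of _ "- p"] exI[of _ q]) (auto simp: ring_of_type polys_in_def)
  next
    case (m_inv h)
    then obtain p q where pq: "p \<in> ?P" "q \<in> ?P" "q \<noteq> 0" "h = Fract p q" by blast
    have "p \<noteq> 0"
      using m_inv.hyps(2) pq(4) by (auto simp: ring_of_type fract_collapse)
    then show ?case
      using pq m_inv.hyps(2) by (intro exI[of _ q] exI[of _ p]) (auto simp: ring_of_type)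
  next
    case (eng_add h1 h2)
    then obtain p q p' q' where "p \<in> ?P" "q \<in> ?P" "q \<noteq> 0" "h1 = Fract p q"
      "p' \<in> ?P" "q' \<in> ?P" "q' \<noteq> 0" "h2 = Fract p' q'" by blast
    then show ?case
      by (intro exI[of _ "p * q' + p' * q"] exI[of _ "q * q'"])
         (auto simp: ring_of_type intro: polys_in_add polys_in_mult)
  next
    case (eng_mult h1 h2)
    then obtain p q p' q' where "p \<in> ?P" "q \<in> ?P" "q \<noteq> 0" "h1 = Fract p q"
      "p' \<in> ?P" "q' \<in> ?P" "q' \<noteq> 0" "h2 = Fract p' q'" by blast
    then show ?case
      by (intro exI[of _ "p * p'"] exI[of _ "q * q'"])
         (auto simp: ring_of_type intro: polys_in_mult)
  qed
  then show ?thesis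
    using that by blast
qed


section \<open>Reduction of polynomials modulo the maximal ideal\<close>

context dvr_with_residue_field
begin

lemma zero_in_R: "0 \<in> R" and one_in_R: "1 \<in> R"
  by (auto simp: valuation_ring val_one)

lemma val_uminus: "\<nu> (- x) = \<nu> x" if "x \<noteq> 0"
proof -
  have "\<nu> (-1) + \<nu> (-1) = 0"
    using val_mult[of "-1" "-1"] by (simp add: val_one)
  then show ?thesis
    using val_mult[of "-1" x] that by simp
qed

lemma uminus_in_R: "- x \<in> R" if "x \<in> R"
  using that by (cases "x = 0") (auto simp: valuation_ring val_uminus)

lemma add_in_R: "x + y \<in> R" if "x \<in> R" "y \<in> R"
  using that val_add[of x y] by (cases "x = 0 \<or> y = 0 \<or> x + y = 0") (auto simp: valuation_ring)

lemma mult_in_R: "x * y \<in> R" if "x \<in> R" "y \<in> R"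
  using that val_mult[of x y] by (cases "x = 0 \<or> y = 0") (auto simp: valuation_ring)

lemma sum_in_R: "(\<Sum>i\<in>A. f i) \<in> R" if "\<And>i. i \<in> A \<Longrightarrow> f i \<in> R"
  using that by (induction A rule: infinite_finite_induct) (auto intro: zero_in_R add_in_R)

lemma residue_eq_0_iff: "\<rho> x = 0 \<longleftrightarrow> x = 0 \<or> 0 < \<nu> x" if "x \<in> R"
  using residue_kernel that unfolding maximal_ideal_def by blast

lemma residue_zero: "\<rho> 0 = 0"
  using residue_eq_0_iff[OF zero_in_R] by simp

lemma residue_uminus: "\<rho> (- x) = - \<rho> x" if "x \<in> R"
proof -
  have "\<rho> (- x) + \<rho> x = 0"
    using residue_add[OF uminus_in_R[OF that] that] residue_zero by simp
  then show ?thesis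
    by (simp add: eq_neg_iff_add_eq_0)
qed

lemma residue_sum: "\<rho> (\<Sum>i\<in>A. f i) = (\<Sum>i\<in>A. \<rho> (f i))" if "\<And>i. i \<in> A \<Longrightarrow> f i \<in> R"
  using that
  by (induction A rule: infinite_finite_induct) (auto simp: residue_zero residue_add sum_in_R)

lemma val_inverse: "\<nu> (inverse x) = - \<nu> x" if "x \<noteq> 0"
  using val_mult[of x "inverse x"] that by (simp add: val_one)

text \<open>The complement of a valuation ring consists of inverses of elements of the maximal
  ideal. In this form the valuation decides below which multiples of a unit can be reduced.\<close>

lemma inverse_residue_zero: "inverse x \<in> R" "\<rho> (inverse x) = 0" if "x \<notin> R"
proof -
  have "x \<noteq> 0" "\<nu> x < 0"
    using that by (auto simp: valuation_ring)
  then have "\<nu> (inverse x) > 0"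
    by (simp add: val_inverse)
  then show "inverse x \<in> R"
    by (simp add: valuation_ring)
  then show "\<rho> (inverse x) = 0"
    using \<open>\<nu> (inverse x) > 0\<close> by (simp add: residue_eq_0_iff)
qed

definition integral_poly :: "('x \<Rightarrow>\<^sub>0 'a) \<Rightarrow> bool" where
  "integral_poly p \<longleftrightarrow> (\<forall>m. Poly_Mapping.lookup p m \<in> R)"

definition reduce_poly :: "('x \<Rightarrow>\<^sub>0 'a) \<Rightarrow> 'x \<Rightarrow>\<^sub>0 'k" where
  "reduce_poly = Poly_Mapping.map \<rho>"

lemma lookup_reduce_poly: "Poly_Mapping.lookup (reduce_poly p) m = \<rho> (Poly_Mapping.lookup p m)"
  by (simp add: reduce_poly_def Poly_Mapping.map.rep_eq when_def residue_zero)

lemma keys_reduce_poly: "Poly_Mapping.keys (reduce_poly p) \<subseteq> Poly_Mapping.keys p"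
  by (auto simp: in_keys_iff lookup_reduce_poly residue_zero)

lemma integral_poly_single: "integral_poly (Poly_Mapping.single m c)" if "c \<in> R"
  using that by (auto simp: integral_poly_def lookup_single when_def zero_in_R)

lemma reduce_poly_single:
  "reduce_poly (Poly_Mapping.single m c) = Poly_Mapping.single m (\<rho> c)"
  by (rule poly_mapping_eqI) (auto simp: lookup_reduce_poly lookup_single when_def residue_zero)

lemma integral_poly_add: "integral_poly (p + q)" if "integral_poly p" "integral_poly q"
  using that by (simp add: integral_poly_def lookup_add add_in_R)

lemma reduce_poly_add:
  "reduce_poly (p + q) = reduce_poly p + reduce_poly q" if "integral_poly p" "integral_poly q"
  using that
  by (intro poly_mapping_eqI) (simp add: lookup_reduce_poly lookup_add residue_add integral_poly_def)

lemma integral_poly_uminus: "integral_poly (- p)" if "integral_poly p"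
  using that by (simp add: integral_poly_def uminus_in_R)

lemma reduce_poly_uminus: "reduce_poly (- p) = - reduce_poly p" if "integral_poly p"
  using that
  by (intro poly_mapping_eqI) (simp add: lookup_reduce_poly residue_uminus integral_poly_def)

lemma integral_poly_sum: "integral_poly (\<Sum>i\<in>A. f i)" if "\<And>i. i \<in> A \<Longrightarrow> integral_poly (f i)"
  using that by (simp add: integral_poly_def lookup_sum sum_in_R)

lemma reduce_poly_sum:
  "reduce_poly (\<Sum>i\<in>A. f i) = (\<Sum>i\<in>A. reduce_poly (f i))"
  if "\<And>i. i \<in> A \<Longrightarrow> integral_poly (f i)"
  using that
  by (intro poly_mapping_eqI) (simp add: lookup_reduce_poly lookup_sum residue_sum integral_poly_def)

text \<open>The residue map is multiplicative on \<open>R\<close> only, so the argument expands both factors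
  into monomials with integral coefficients.\<close>

lemma integral_poly_mult_reduce:
  fixes p q :: "'x::comm_monoid_add \<Rightarrow>\<^sub>0 'a"
  assumes "integral_poly p" "integral_poly q"
  shows "integral_poly (p * q) \<and> reduce_poly (p * q) = reduce_poly p * reduce_poly q"
proof -
  let ?s = "\<lambda>p m. Poly_Mapping.single m (Poly_Mapping.lookup p m)"
  have s: "integral_poly (?s p m * ?s q n)"
    "reduce_poly (?s p m * ?s q n) = reduce_poly (?s p m) * reduce_poly (?s q n)" for m n
    using assms
    unfolding integral_poly_def[of p] integral_poly_def[of q]
    by (simp_all add: mult_single integral_poly_single mult_in_R reduce_poly_single residue_mult)
  have si: "integral_poly (?s p m)" "integral_poly (?s q m)" for m
    using assms unfolding integral_poly_def[of p] integral_poly_def[of q]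
    by (simp_all add: integral_poly_single)
  have eq: "p * q = (\<Sum>m\<in>Poly_Mapping.keys p. \<Sum>n\<in>Poly_Mapping.keys q. ?s p m * ?s q n)"
    using poly_mapping_sum_single[of p] poly_mapping_sum_single[of q]
    by (metis (no_types) sum_product)
  have "reduce_poly (p * q) =
      (\<Sum>m\<in>Poly_Mapping.keys p. \<Sum>n\<in>Poly_Mapping.keys q. reduce_poly (?s p m) * reduce_poly (?s q n))"
    unfolding eq by (simp add: reduce_poly_sum integral_poly_sum s)
  also have "\<dots> = reduce_poly (\<Sum>m\<in>Poly_Mapping.keys p. ?s p m) * reduce_poly (\<Sum>m\<in>Poly_Mapping.keys q. ?s q m)"
    by (simp add: reduce_poly_sum si sum_product)
  also have "\<dots> = reduce_poly p * reduce_poly q"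
    by (simp only: poly_mapping_sum_single[symmetric])
  finally show ?thesis
    unfolding eq by (auto intro!: integral_poly_sum s)
qed

lemmas integral_poly_mult = integral_poly_mult_reduce[THEN conjunct1]
lemmas reduce_poly_mult = integral_poly_mult_reduce[THEN conjunct2]

text \<open>Dividing by a coefficient of least valuation makes all coefficients integral and turns
  that coefficient into \<open>1\<close>. Thus the scaling factor that makes a polynomial primitive can be
  taken from the ground field \<open>K\<close>.\<close>

lemma primitive_part_exists:
  fixes p :: "'x::comm_monoid_add \<Rightarrow>\<^sub>0 'a"
  assumes "p \<noteq> 0"
  shows "\<exists>c p'. c \<noteq> 0 \<and> p = Poly_Mapping.single 0 c * p' \<and> integral_poly p' \<and>
    reduce_poly p' \<noteq> 0 \<and> Poly_Mapping.keys p' = Poly_Mapping.keys p"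
proof -
  let ?K = "Poly_Mapping.keys p" and ?l = "Poly_Mapping.lookup p"
  have ne: "?K \<noteq> {}"
    using assms by (metis keys_eq_empty)
  obtain m where m: "m \<in> ?K" "\<And>n. n \<in> ?K \<Longrightarrow> \<nu> (?l m) \<le> \<nu> (?l n)"
    using arg_min_if_finite[OF finite_keys ne, of "\<lambda>n. \<nu> (?l n)"] by (metis linorder_not_less)
  define c where "c = ?l m"
  define p' where "p' = Poly_Mapping.map ((*) (inverse c)) p"
  have c: "c \<noteq> 0"
    using m(1) by (simp add: c_def in_keys_iff)
  have l: "Poly_Mapping.lookup p' n = inverse c * ?l n" for n
    by (simp add: p'_def Poly_Mapping.map.rep_eq when_def)
  have "p = Poly_Mapping.single 0 c * p'"
    by (rule poly_mapping_eqI)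
       (simp add: mult_map_scale_conv_mult[symmetric] Poly_Mapping.map.rep_eq when_def l c)
  moreover have "integral_poly p'"
    unfolding integral_poly_def
  proof
    fix n
    show "Poly_Mapping.lookup p' n \<in> R"
      using m(2)[of n] c
      by (cases "?l n = 0")
         (auto simp: l valuation_ring in_keys_iff val_mult val_inverse c_def)
  qed
  moreover have "Poly_Mapping.lookup (reduce_poly p') m \<noteq> 0"
    using c by (simp add: lookup_reduce_poly l c_def[symmetric] residue_one)
  then have "reduce_poly p' \<noteq> 0"
    by auto
  moreover have "Poly_Mapping.keys p' = ?K"
    using c by (auto simp: in_keys_iff l)
  ultimately show ?thesis
    using c by blast
qed

lemma mpoly_translate_reduce:
  fixes p :: "('g indet \<Rightarrow>\<^sub>0 nat) \<Rightarrow>\<^sub>0 'a"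
  assumes "integral_poly p"
  shows "integral_poly (mpoly_translate G g p)"
    and "reduce_poly (mpoly_translate G g p) = mpoly_translate G g (reduce_poly p)"
proof -
  have i: "integral_poly (Poly_Mapping.single x (Poly_Mapping.lookup p m))"
    for m and x :: "'g indet \<Rightarrow>\<^sub>0 nat"
    using assms unfolding integral_poly_def[of p] by (simp add: integral_poly_single)
  show "integral_poly (mpoly_translate G g p)"
    unfolding mpoly_translate_expand by (intro integral_poly_sum i)
  show "reduce_poly (mpoly_translate G g p) = mpoly_translate G g (reduce_poly p)"
    unfolding mpoly_translate_expand
    by (simp add: reduce_poly_sum i reduce_poly_single lookup_reduce_poly)
       (rule sum.mono_neutral_right,
         auto simp: in_keys_iff lookup_reduce_poly residue_zero)
qed


section \<open>Reduction of rational functions\<close>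

text \<open>The valuation ring of the Gauss valuation on \<open>K(V)\<close> consists of the quotients \<open>a/b\<close>
  with integral \<open>a\<close>, \<open>b\<close> such that \<open>b\<close> is primitive. The residue map is presented by its graph:
  \<open>reduces r s\<close> says that \<open>r\<close> lies in the valuation ring and has residue \<open>s\<close>. A relation
  avoids a choice of representatives and needs no values outside the valuation ring.\<close>

definition reduces :: "('g, 'a) ratfun \<Rightarrow> ('g, 'k) ratfun \<Rightarrow> bool" where
  "reduces r s \<longleftrightarrow> (\<exists>a b. integral_poly a \<and> integral_poly b \<and> reduce_poly b \<noteq> 0 \<and>
     r = Fract a b \<and> s = Fract (reduce_poly a) (reduce_poly b))"

lemma reduce_poly_zero: "reduce_poly 0 = 0"
  by (rule poly_mapping_eqI) (simp add: lookup_reduce_poly residue_zero)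

lemma reducesE:
  assumes "reduces r s"
  obtains a b where "integral_poly a" "integral_poly b" "reduce_poly b \<noteq> 0" "b \<noteq> 0"
    "r = Fract a b" "s = Fract (reduce_poly a) (reduce_poly b)"
proof -
  obtain a b where "integral_poly a" "integral_poly b" "reduce_poly b \<noteq> 0"
    "r = Fract a b" "s = Fract (reduce_poly a) (reduce_poly b)"
    using assms unfolding reduces_def by blast
  moreover from this(3) have "b \<noteq> 0"
    by (auto simp: reduce_poly_zero)
  ultimately show thesis
    by (intro that)
qed

text \<open>If \<open>a d = c b\<close>, then the reductions satisfy the same equation, and the reduced
  denominators can be cancelled because polynomials over \<open>k\<close> form an integral domain.\<close>

lemma reduces_unique: "s = s'" if prems: "reduces r s" "reduces r s'"
proof -
  obtain a b where ab: "integral_poly a" "integral_poly b" "reduce_poly b \<noteq> 0" "b \<noteq> 0"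
    "r = Fract a b" "s = Fract (reduce_poly a) (reduce_poly b)"
    using prems(1) by (rule reducesE)
  obtain c d where cd: "integral_poly c" "integral_poly d" "reduce_poly d \<noteq> 0" "d \<noteq> 0"
    "r = Fract c d" "s' = Fract (reduce_poly c) (reduce_poly d)"
    using prems(2) by (rule reducesE)
  have "a * d = c * b"
    using ab(5) cd(5) eq_fract(1)[OF ab(4) cd(4)] by metis
  then have "reduce_poly a * reduce_poly d = reduce_poly c * reduce_poly b"
    using ab cd by (metis reduce_poly_mult)
  then show ?thesis
    using ab(3,6) cd(3,6) by (simp add: eq_fract)
qed

lemma reduces_add: "reduces (r + r') (s + s')" if prems: "reduces r s" "reduces r' s'"
proof -
  obtain a b where ab: "integral_poly a" "integral_poly b" "reduce_poly b \<noteq> 0" "b \<noteq> 0"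
    "r = Fract a b" "s = Fract (reduce_poly a) (reduce_poly b)"
    using prems(1) by (rule reducesE)
  obtain c d where cd: "integral_poly c" "integral_poly d" "reduce_poly d \<noteq> 0" "d \<noteq> 0"
    "r' = Fract c d" "s' = Fract (reduce_poly c) (reduce_poly d)"
    using prems(2) by (rule reducesE)
  show ?thesis
    unfolding reduces_def
    by (intro exI[of _ "a * d + c * b"] exI[of _ "b * d"])
       (use ab cd in \<open>simp add: integral_poly_add integral_poly_mult reduce_poly_add reduce_poly_mult\<close>)
qed

lemma reduces_mult: "reduces (r * r') (s * s')" if prems: "reduces r s" "reduces r' s'"
proof -
  obtain a b where ab: "integral_poly a" "integral_poly b" "reduce_poly b \<noteq> 0" "b \<noteq> 0"
    "r = Fract a b" "s = Fract (reduce_poly a) (reduce_poly b)"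
    using prems(1) by (rule reducesE)
  obtain c d where cd: "integral_poly c" "integral_poly d" "reduce_poly d \<noteq> 0" "d \<noteq> 0"
    "r' = Fract c d" "s' = Fract (reduce_poly c) (reduce_poly d)"
    using prems(2) by (rule reducesE)
  show ?thesis
    unfolding reduces_def
    by (intro exI[of _ "a * c"] exI[of _ "b * d"])
       (use ab cd in \<open>simp add: integral_poly_mult reduce_poly_mult\<close>)
qed

lemma reduces_uminus: "reduces (- r) (- s)" if prems: "reduces r s"
proof -
  obtain a b where ab: "integral_poly a" "integral_poly b" "reduce_poly b \<noteq> 0" "b \<noteq> 0"
    "r = Fract a b" "s = Fract (reduce_poly a) (reduce_poly b)"
    using prems by (rule reducesE)
  show ?thesis
    unfolding reduces_def
    by (intro exI[of _ "- a"] exI[of _ b])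
       (use ab in \<open>simp add: integral_poly_uminus reduce_poly_uminus\<close>)
qed

lemma reduces_inverse: "reduces (inverse r) (inverse s)" if prems: "reduces r s" "s \<noteq> 0"
proof -
  obtain a b where ab: "integral_poly a" "integral_poly b" "reduce_poly b \<noteq> 0" "b \<noteq> 0"
    "r = Fract a b" "s = Fract (reduce_poly a) (reduce_poly b)"
    using prems(1) by (rule reducesE)
  have "reduce_poly a \<noteq> 0"
    using prems(2) ab(6) by (metis fract_collapse(1))
  then show ?thesis
    unfolding reduces_def
    by (intro exI[of _ b] exI[of _ a]) (use ab in simp)
qed

lemma reduces_const:
  "reduces (ratfun_const c :: ('g, 'a) ratfun) (ratfun_const (\<rho> c))" if "c \<in> R"
  unfolding reduces_def ratfun_const_def
  using that integral_poly_single[OF one_in_R, of "0 :: 'g indet \<Rightarrow>\<^sub>0 nat"]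
    reduce_poly_single[of "0 :: 'g indet \<Rightarrow>\<^sub>0 nat" 1]
  by - (rule exI[of _ "Poly_Mapping.single 0 c"], rule exI[of _ 1],
        simp add: integral_poly_single reduce_poly_single residue_one)

lemma reduces_zero: "reduces 0 0" and reduces_one: "reduces 1 1"
  using reduces_const[OF zero_in_R] reduces_const[OF one_in_R]
  by (simp_all add: ratfun_const_hom residue_zero residue_one)

lemma reduces_sum: "reduces (\<Sum>i\<in>A. f i) (\<Sum>i\<in>A. h i)" if "\<And>i. i \<in> A \<Longrightarrow> reduces (f i) (h i)"
  using that
  by (induction A rule: infinite_finite_induct) (auto intro: reduces_zero reduces_add)

lemma reduces_prod: "reduces (\<Prod>i\<in>A. f i) (\<Prod>i\<in>A. h i)" if "\<And>i. i \<in> A \<Longrightarrow> reduces (f i) (h i)"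
  using that
  by (induction A rule: infinite_finite_induct) (auto intro: reduces_one reduces_mult)

lemma reduces_power: "reduces (r ^ n) (s ^ n)" if "reduces r s"
  using that by (induction n) (auto intro: reduces_one reduces_mult)

lemma reduces_regular_action:
  assumes "group G" "g \<in> carrier G" "reduces r s"
  shows "reduces (regular_action G g r) (regular_action G g s)"
proof -
  obtain a b where ab: "integral_poly a" "integral_poly b" "reduce_poly b \<noteq> 0" "b \<noteq> 0"
    "r = Fract a b" "s = Fract (reduce_poly a) (reduce_poly b)"
    using assms(3) by (rule reducesE)
  have "reduce_poly (mpoly_translate G g b) \<noteq> 0"
    using ab(2,3) assms(1,2) by (simp add: mpoly_translate_reduce mpoly_translate_eq_0_iff)
  then show ?thesis
    unfolding reduces_def
    by (intro exI[of _ "mpoly_translate G g a"] exI[of _ "mpoly_translate G g b"])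
       (use ab in \<open>simp add: mpoly_translate_reduce regular_action_Fract[OF assms(1,2)]\<close>)
qed

text \<open>Taking primitive parts of numerator and denominator writes every nonzero rational
  function as a constant times a unit of the Gauss valuation ring; the variables that occur
  do not change.\<close>

lemma scaled_reduction_exists:
  fixes a b :: "('g indet \<Rightarrow>\<^sub>0 nat) \<Rightarrow>\<^sub>0 'a"
  assumes "a \<noteq> 0" "b \<noteq> 0"
  shows "\<exists>c a' b'. c \<noteq> 0 \<and> Fract a b = ratfun_const c * Fract a' b' \<and>
    reduces (Fract a' b') (Fract (reduce_poly a') (reduce_poly b')) \<and>
    reduce_poly a' \<noteq> 0 \<and> reduce_poly b' \<noteq> 0 \<and>
    Poly_Mapping.keys a' = Poly_Mapping.keys a \<and> Poly_Mapping.keys b' = Poly_Mapping.keys b"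
proof -
  obtain c a' where a: "c \<noteq> 0" "a = Poly_Mapping.single 0 c * a'" "integral_poly a'"
    "reduce_poly a' \<noteq> 0" "Poly_Mapping.keys a' = Poly_Mapping.keys a"
    using primitive_part_exists[OF assms(1)] by blast
  obtain d b' where b: "d \<noteq> 0" "b = Poly_Mapping.single 0 d * b'" "integral_poly b'"
    "reduce_poly b' \<noteq> 0" "Poly_Mapping.keys b' = Poly_Mapping.keys b"
    using primitive_part_exists[OF assms(2)] by blast
  have "Fract a b = Fract (Poly_Mapping.single 0 c) (Poly_Mapping.single 0 d) * Fract a' b'"
    by (simp add: a(2) b(2))
  also have "Fract (Poly_Mapping.single 0 c) (Poly_Mapping.single 0 d) =
      (ratfun_const c * inverse (ratfun_const d) :: ('g, 'a) ratfun)"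
    by (simp add: ratfun_const_def)
  also have "\<dots> = ratfun_const (c * inverse d)"
    by (simp only: ratfun_const_hom ratfun_const_inverse)
  finally have "Fract a b = ratfun_const (c * inverse d) * Fract a' b'" .
  moreover have "reduces (Fract a' b') (Fract (reduce_poly a') (reduce_poly b'))"
    using a b unfolding reduces_def by blast
  moreover have "c * inverse d \<noteq> 0"
    using a(1) b(1) by simp
  ultimately show ?thesis
    using a(4,5) b(4,5) by blast
qed

text \<open>The Gauss valuation has the same value group as \<open>\<nu>\<close>: every nonzero element becomes
  a unit after division by an element of \<open>K\<close>. As \<open>K\<close> is fixed by \<open>G\<close>, this is where the
  proof gains control over inertia.\<close>

lemma unit_multiple_exists:
  fixes r :: "('g, 'a) ratfun"
  assumes "r \<noteq> 0"
  shows "\<exists>c u s. c \<noteq> 0 \<and> r = ratfun_const c * u \<and> reduces u s \<and> s \<noteq> 0"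
proof -
  obtain a b where ab: "r = Fract a b" "b \<noteq> 0" by (rule Fract_cases)
  then have "a \<noteq> 0"
    using assms by (metis fract_collapse(1))
  from scaled_reduction_exists[OF this ab(2)] obtain c a' b' where
    "c \<noteq> 0" "Fract a b = ratfun_const c * Fract a' b'"
    "reduces (Fract a' b') (Fract (reduce_poly a') (reduce_poly b'))"
    "reduce_poly a' \<noteq> 0" "reduce_poly b' \<noteq> 0"
    by blast
  moreover from this(4,5) have "Fract (reduce_poly a') (reduce_poly b') \<noteq> 0"
    by (simp add: Zero_fract_def eq_fract)
  ultimately show ?thesis
    using ab(1) by blast
qed

text \<open>A constant multiple of a unit can be reduced only if the constant is integral: otherwise
  its inverse lies in the maximal ideal, and the unit would have residue \<open>0\<close>.\<close>

lemma reduction_eq_scaled_residue: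
  assumes "reduces (ratfun_const c * u) s" "reduces u t" "t \<noteq> 0"
  shows "c \<in> R" and "s = ratfun_const (\<rho> c) * t"
proof -
  show c: "c \<in> R"
  proof (rule ccontr)
    assume nin: "c \<notin> R"
    then have "c \<noteq> 0"
      using zero_in_R by auto
    have "reduces (ratfun_const (inverse c) * (ratfun_const c * u)) (ratfun_const 0 * s)"
      using reduces_mult[OF reduces_const[OF inverse_residue_zero(1)[OF nin]] assms(1)]
        inverse_residue_zero(2)[OF nin] by simp
    moreover have "ratfun_const (inverse c) * (ratfun_const c * u) = u"
      using \<open>c \<noteq> 0\<close> by (simp add: ratfun_const_inverse ratfun_const_eq_0_iff)
    ultimately have "reduces u 0"
      by (simp add: ratfun_const_hom)
    then show False
      using reduces_unique[OF assms(2)] assms(3) by blast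
  qed
  show "s = ratfun_const (\<rho> c) * t"
    using reduces_unique[OF assms(1) reduces_mult[OF reduces_const[OF c] assms(2)]] .
qed

text \<open>Numerator and denominator can be made primitive without introducing new variables, and
  reduction deletes monomials but creates none.\<close>

lemma reduction_in_regular_function_field:
  assumes "r \<in> regular_function_field G" "reduces r s"
  shows "s \<in> regular_function_field G"
proof -
  let ?A = "Indet ` carrier G"
  note F = subfield_regular_function_field[of G, where 'f = 'k]
  obtain p q where pq: "p \<in> polys_in ?A" "q \<in> polys_in ?A" "q \<noteq> 0" "r = Fract p q"
    using assms(1) by (rule regular_function_fieldE)
  show ?thesis
  proof (cases "p = 0")
    case True
    then have "s = ratfun_const 0"
      using reduces_unique[OF assms(2)] reduces_zero pq(4)
      by (simp add: fract_collapse ratfun_const_hom)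
    then show ?thesis
      by (simp only: const_in_regular_function_field)
  next
    case False
    obtain c a b where ab: "Fract p q = ratfun_const c * Fract a b"
      "reduces (Fract a b) (Fract (reduce_poly a) (reduce_poly b))"
      "reduce_poly a \<noteq> 0" "reduce_poly b \<noteq> 0"
      "Poly_Mapping.keys a = Poly_Mapping.keys p" "Poly_Mapping.keys b = Poly_Mapping.keys q"
      using scaled_reduction_exists[OF False pq(3)] by blast
    have "Fract (reduce_poly a) (reduce_poly b) \<noteq> 0"
      using ab(3,4) by (simp add: Zero_fract_def eq_fract)
    then have s: "s = ratfun_const (\<rho> c) * Fract (reduce_poly a) (reduce_poly b)"
      using reduction_eq_scaled_residue(2)[OF _ ab(2)] assms(2) pq(4) ab(1) by metis
    have "reduce_poly a \<in> polys_in ?A" "reduce_poly b \<in> polys_in ?A"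
      using pq(1,2) ab(5,6) keys_reduce_poly[of a] keys_reduce_poly[of b]
      unfolding polys_in_def by blast+
    then show ?thesis
      using Fract_in_regular_function_field[OF _ _ ab(4)] F const_in_regular_function_field
      unfolding s subfield_of_type_iff by blast
  qed
qed

section \<open>The residue field of an intermediate field\<close>

text \<open>The residue field of the restriction to \<open>L\<close> of the Gauss valuation, as a subset of
  \<open>k(V)\<close>.\<close>

definition residue_field :: "('g, 'a) ratfun set \<Rightarrow> ('g, 'k) ratfun set" where
  "residue_field L = {s. \<exists>r\<in>L. reduces r s}"

lemma subfield_residue_field:
  assumes "subfield L ring_of_type_algebra"
  shows "subfield (residue_field L) ring_of_type_algebra"
  unfolding subfield_of_type_iff
proof (intro conjI ballI impI)
  note L = assms[unfolded subfield_of_type_iff]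
  show "1 \<in> residue_field L"
    using L reduces_one unfolding residue_field_def by blast
  fix x assume "x \<in> residue_field L"
  then obtain r where r: "r \<in> L" "reduces r x"
    unfolding residue_field_def by blast
  show "- x \<in> residue_field L"
    using r L reduces_uminus unfolding residue_field_def by blast
  show "inverse x \<in> residue_field L" if x: "x \<noteq> 0"
  proof -
    have "r \<noteq> 0"
      using r(2) x reduces_unique[OF _ reduces_zero] by blast
    then show ?thesis
      using r L reduces_inverse[OF r(2) x] unfolding residue_field_def by blast
  qed
  fix y assume "y \<in> residue_field L"
  then obtain t where t: "t \<in> L" "reduces t y"
    unfolding residue_field_def by blast
  show "x + y \<in> residue_field L" "x * y \<in> residue_field L"
    using r t L reduces_add[OF r(2) t(2)] reduces_mult[OF r(2) t(2)]
    unfolding residue_field_def by blast+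
qed

lemma consts_in_residue_field:
  fixes L :: "('g, 'a) ratfun set"
  assumes "range ratfun_const \<subseteq> L"
  shows "range ratfun_const \<subseteq> residue_field L"
proof
  fix s :: "('g, 'k) ratfun" assume "s \<in> range ratfun_const"
  then obtain x where x: "s = ratfun_const x" by blast
  obtain c where c: "c \<in> R" "\<rho> c = x"
    using residue_onto by (metis UNIV_I imageE)
  then show "s \<in> residue_field L"
    using assms reduces_const[OF c(1)] x unfolding residue_field_def by blast
qed

text \<open>Lifts of algebraically independent residues are algebraically independent: a relation
  between the lifts can be divided by a constant until its coefficients are integral and not all
  in the maximal ideal, and then it reduces to a nontrivial relation between the residues.\<close>

lemma trdeg_residue_field_le:
  fixes L :: "('g, 'a) ratfun set"
  shows "trdeg ratfun_const (residue_field L) \<le> trdeg ratfun_const L"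
  unfolding trdeg_def[of _ "residue_field L"]
proof (rule SUP_least, clarify)
  fix S assume S: "finite S" "S \<subseteq> residue_field L"
    and indep: "alg_independent (ratfun_const :: 'k \<Rightarrow> ('g, 'k) ratfun) S"
  have "\<forall>s\<in>S. \<exists>r. r \<in> L \<and> reduces r s"
    using S(2) unfolding residue_field_def by blast
  then obtain lift where lift: "\<And>s. s \<in> S \<Longrightarrow> lift s \<in> L" "\<And>s. s \<in> S \<Longrightarrow> reduces (lift s) s"
    by metis
  have inj: "inj_on lift S"
    using lift(2) reduces_unique by (metis inj_onI)
  \<comment> \<open>Renames the variables of a monomial from the lifts to their residues.\<close>
  define ren :: "(('g, 'a) ratfun \<Rightarrow>\<^sub>0 nat) \<Rightarrow> ('g, 'k) ratfun \<Rightarrow>\<^sub>0 nat" where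
    "ren m = Abs_poly_mapping (\<lambda>s. if s \<in> S then Poly_Mapping.lookup m (lift s) else 0)" for m
  have ren: "Poly_Mapping.lookup (ren m) s = (if s \<in> S then Poly_Mapping.lookup m (lift s) else 0)"
    for m s
  proof -
    have "finite {s. (if s \<in> S then Poly_Mapping.lookup m (lift s) else 0) \<noteq> 0}"
      by (rule finite_subset[OF _ S(1)]) auto
    then show ?thesis
      unfolding ren_def by simp
  qed
  have ren_keys: "Poly_Mapping.keys (ren m) \<subseteq> S" for m
    by (auto simp: in_keys_iff ren split: if_splits)
  have ren_inj: "m = n"
    if "Poly_Mapping.keys m \<subseteq> lift ` S" "Poly_Mapping.keys n \<subseteq> lift ` S" "ren m = ren n" for m n
  proof (rule poly_mapping_eqI)
    fix v
    show "Poly_Mapping.lookup m v = Poly_Mapping.lookup n v"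
    proof (cases "v \<in> lift ` S")
      case True
      then obtain s where "s \<in> S" "v = lift s" by blast
      then show ?thesis
        using arg_cong[OF that(3), of "\<lambda>m. Poly_Mapping.lookup m s"] by (simp add: ren)
    next
      case False
      then have "v \<notin> Poly_Mapping.keys m" "v \<notin> Poly_Mapping.keys n"
        using that(1,2) by blast+
      then show ?thesis
        by (simp add: in_keys_iff)
    qed
  qed
  have "alg_independent (ratfun_const :: 'a \<Rightarrow> ('g, 'a) ratfun) (lift ` S)"
    unfolding alg_independent_def
  proof (intro allI impI, rule ccontr)
    fix p :: "(('g, 'a) ratfun \<Rightarrow>\<^sub>0 nat) \<Rightarrow>\<^sub>0 'a"
    assume keys: "\<forall>m\<in>Poly_Mapping.keys p. Poly_Mapping.keys m \<subseteq> lift ` S"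
      and root: "mpoly_eval ratfun_const (\<lambda>s. s) p = 0" and "p \<noteq> 0"
    obtain c p' where p': "c \<noteq> 0" "p = Poly_Mapping.single 0 c * p'" "integral_poly p'"
      "reduce_poly p' \<noteq> 0" "Poly_Mapping.keys p' = Poly_Mapping.keys p"
      using primitive_part_exists[OF \<open>p \<noteq> 0\<close>] by blast
    let ?E = "mpoly_eval (ratfun_const :: 'a \<Rightarrow> ('g, 'a) ratfun) (\<lambda>s. s)"
    have "?E p = ratfun_const c * ?E p'"
      unfolding p'(2) by (simp add: mpoly_eval_mult mpoly_eval_const ratfun_const_hom)
    then have root': "?E p' = 0"
      using root p'(1) by (simp add: ratfun_const_eq_0_iff)
    let ?K = "Poly_Mapping.keys p'" and ?l = "\<lambda>m. \<rho> (Poly_Mapping.lookup p' m)"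
    \<comment> \<open>The relation between the residues obtained by reducing the coefficients of \<open>p'\<close>.\<close>
    define q where "q = (\<Sum>m\<in>?K. Poly_Mapping.single (ren m) (?l m))"
    have monom: "reduces (\<Prod>v\<in>Poly_Mapping.keys m. v ^ Poly_Mapping.lookup m v)
        (\<Prod>s\<in>Poly_Mapping.keys (ren m). s ^ Poly_Mapping.lookup (ren m) s)" if "m \<in> ?K" for m
    proof -
      have "(\<Prod>v\<in>Poly_Mapping.keys m. v ^ Poly_Mapping.lookup m v) =
          (\<Prod>v\<in>lift ` S. v ^ Poly_Mapping.lookup m v)"
        using prod_keys_superset[of "lift ` S" m "\<lambda>v. v"] S(1) keys that p'(5) by simp
      also have "\<dots> = (\<Prod>s\<in>S. lift s ^ Poly_Mapping.lookup m (lift s))"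
        by (simp add: prod.reindex[OF inj])
      finally have 1: "(\<Prod>v\<in>Poly_Mapping.keys m. v ^ Poly_Mapping.lookup m v) = \<dots>" .
      have "(\<Prod>s\<in>Poly_Mapping.keys (ren m). s ^ Poly_Mapping.lookup (ren m) s) =
          (\<Prod>s\<in>S. s ^ Poly_Mapping.lookup (ren m) s)"
        using prod_keys_superset[OF S(1) ren_keys, of "\<lambda>v. v"] by simp
      also have "\<dots> = (\<Prod>s\<in>S. s ^ Poly_Mapping.lookup m (lift s))"
        by (rule prod.cong) (simp_all add: ren)
      finally show ?thesis
        unfolding 1 by (simp add: reduces_prod reduces_power lift(2))
    qed
    have "mpoly_eval ratfun_const (\<lambda>s. s) q = (\<Sum>m\<in>?K. ratfun_const (?l m) *
        (\<Prod>s\<in>Poly_Mapping.keys (ren m). s ^ Poly_Mapping.lookup (ren m) s))"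
      unfolding q_def by (simp add: mpoly_eval_sum mpoly_eval_single ratfun_const_hom)
    moreover have "reduces (?E p') \<dots>"
      unfolding mpoly_eval_def
      using p'(3) unfolding integral_poly_def
      by (intro reduces_sum reduces_mult reduces_const monom) auto
    ultimately have "mpoly_eval ratfun_const (\<lambda>s. s) q = 0"
      using reduces_unique reduces_zero root' by metis
    moreover have "\<forall>m\<in>Poly_Mapping.keys q. Poly_Mapping.keys m \<subseteq> S"
    proof
      fix m assume "m \<in> Poly_Mapping.keys q"
      then have "m \<in> (\<Union>n\<in>?K. Poly_Mapping.keys (Poly_Mapping.single (ren n) (?l n)))"
        using Poly_Mapping.keys_sum[of "\<lambda>m. Poly_Mapping.single (ren m) (?l m)" ?K]
        unfolding q_def by blast
      then show "Poly_Mapping.keys m \<subseteq> S"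
        using ren_keys by (auto split: if_splits)
    qed
    ultimately have "q = 0"
      using indep unfolding alg_independent_def by blast
    have "reduce_poly p' = 0"
    proof (rule poly_mapping_eqI)
      fix m
      show "Poly_Mapping.lookup (reduce_poly p') m = Poly_Mapping.lookup 0 m"
      proof (cases "m \<in> ?K")
        case True
        \<comment> \<open>Renaming is injective on the monomials of \<open>p'\<close>, so no two coefficients are merged.\<close>
        have "0 = Poly_Mapping.lookup q (ren m)"
          using \<open>q = 0\<close> by simp
        also have "\<dots> = (\<Sum>n\<in>?K. if n = m then ?l n else 0)"
          unfolding q_def lookup_sum lookup_single
          using True keys p'(5) ren_inj by (intro sum.cong) (auto simp: when_def)
        finally show ?thesis
          using True by (simp add: lookup_reduce_poly)
      qed (simp add: lookup_reduce_poly in_keys_iff residue_zero)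
    qed
    then show False
      using p'(4) by blast
  qed
  then have "lift ` S \<in> {S. finite S \<and> S \<subseteq> L \<and> alg_independent (ratfun_const :: 'a \<Rightarrow> ('g, 'a) ratfun) S}"
    using S(1) lift(1) by blast
  then have "enat (card (lift ` S)) \<le> trdeg (ratfun_const :: 'a \<Rightarrow> ('g, 'a) ratfun) L"
    unfolding trdeg_def by (rule SUP_upper)
  then show "enat (card S) \<le> trdeg (ratfun_const :: 'a \<Rightarrow> ('g, 'a) ratfun) L"
    by (simp add: card_image[OF inj])
qed

lemma residue_field_invariant:
  assumes "group G" "g \<in> carrier G" "regular_action G g ` L \<subseteq> L"
  shows "regular_action G g ` residue_field L \<subseteq> residue_field L"
  using assms(3) reduces_regular_action[OF assms(1,2)] unfolding residue_field_def by blast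

section \<open>Inertia and faithfulness\<close>

text \<open>Suppose that \<open>g\<close> acts trivially on residues and moves \<open>x\<close>. Scale \<open>g x - x\<close> by a
  constant \<open>c\<close> to a unit \<open>u\<close> of \<open>L\<close> with residue \<open>s \<noteq> 0\<close>. The sum of \<open>g\<^sup>j u\<close> over
  \<open>j < q\<close> telescopes to \<open>(g\<^sup>q x - x) / c = 0\<close>, whereas each summand has residue \<open>s\<close>.
  Hence \<open>q s = 0\<close>, so \<open>q\<close> vanishes in \<open>k\<close>.\<close>

lemma char_eq_order_of_inertia_element:
  fixes L :: "('g, 'a) ratfun set" and G :: "('g, 'm) monoid_scheme"
  assumes "group G" "g \<in> carrier G" "prime q" "g [^]\<^bsub>G\<^esub> q = \<one>\<^bsub>G\<^esub>"
    and L: "subfield L ring_of_type_algebra" "range ratfun_const \<subseteq> L" "regular_action G g ` L \<subseteq> L"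
    and trivial: "\<And>s. s \<in> residue_field L \<Longrightarrow> regular_action G g s = s"
    and moved: "x \<in> L" "regular_action G g x \<noteq> x"
  shows "CHAR('k) = q"
proof -
  interpret group G by fact
  let ?a = "\<lambda>j::nat. regular_action G (g [^]\<^bsub>G\<^esub> j)"
  note L' = L(1)[unfolded subfield_of_type_iff]
  define y where "y = regular_action G g x - x"
  have "y \<noteq> 0"
    using moved by (simp add: y_def)
  then obtain c u s where u: "c \<noteq> 0" "y = ratfun_const c * u" "reduces u s" "s \<noteq> 0"
    using unit_multiple_exists by blast
  have "y \<in> L"
    using moved(1) L(3) L' unfolding y_def by (metis diff_conv_add_uminus image_subset_iff)
  moreover have u_eq: "u = ratfun_const (inverse c) * y"
    using u(1,2) by (simp add: ratfun_const_inverse ratfun_const_eq_0_iff)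
  ultimately have "u \<in> L"
    using L(2) L' by blast
  then have "s \<in> residue_field L"
    using u(3) unfolding residue_field_def by blast
  have step: "?a (Suc j) r = ?a j (regular_action G g r)" for j :: nat and r :: "('g, 'f::field) ratfun"
    using assms(1,2) by (simp add: regular_action_mult(1))
  have fixed: "?a j s = s" for j :: nat
  proof (induction j)
    case 0
    show ?case
      using regular_action_mult(2)[OF assms(1,2,2)] by simp
  next
    case (Suc j)
    then show ?case
      unfolding step trivial[OF \<open>s \<in> residue_field L\<close>] .
  qed
  have conj: "?a j u = ratfun_const (inverse c) * (?a (Suc j) x - ?a j x)" for j :: nat
    unfolding u_eq y_def step
    using assms(1,2) by (simp add: regular_action_hom regular_action_diff)
  have "(\<Sum>j<q. ?a j u) = ratfun_const (inverse c) * (\<Sum>j<q. ?a (Suc j) x - ?a j x)"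
    unfolding conj by (simp only: sum_distrib_left)
  also have "(\<Sum>j<q. ?a (Suc j) x - ?a j x) = ?a q x - ?a 0 x"
    by (rule sum_lessThan_telescope[of "\<lambda>j. ?a j x"])
  also have "\<dots> = 0"
    using assms(4) by simp
  finally have "(\<Sum>j<q. ?a j u) = 0"
    by simp
  moreover have "reduces (\<Sum>j<q. ?a j u) (\<Sum>j<q. ?a j s)"
    using assms(1,2) u(3) by (intro reduces_sum reduces_regular_action) auto
  ultimately have "(\<Sum>j<q. ?a j s) = 0"
    using reduces_unique reduces_zero by metis
  then have "of_nat q * s = 0"
    by (simp add: fixed)
  then have "(ratfun_const (of_nat q :: 'k) :: ('g, 'k) ratfun) = 0"
    using u(4) by (simp add: ratfun_const_of_nat)
  then have "CHAR('k) dvd q"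
    by (simp add: ratfun_const_eq_0_iff of_nat_eq_0_iff_char_dvd)
  then show ?thesis
    using assms(3) CHAR_not_1'[where 'a = 'k] by (metis One_nat_def prime_nat_iff)
qed

text \<open>By Cauchy's theorem and the preceding lemma, every prime divisor of the order of the
  kernel \<open>N\<close> of the action on residues is the characteristic of \<open>k\<close>. So \<open>N\<close> is a normal
  subgroup of prime power order, hence trivial by weak tameness; in characteristic zero its order
  has no prime divisor.\<close>

lemma residue_field_faithful:
  fixes L :: "('g, 'a) ratfun set" and G :: "('g, 'm) monoid_scheme"
  assumes G: "group G" "finite (carrier G)" "CHAR('k) > 0 \<Longrightarrow> weakly_tame CHAR('k) G"
    and L: "L \<in> faithful_intermediate_fields G"
  shows "residue_field L \<in> faithful_intermediate_fields G"
proof -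
  interpret group G by fact
  have L': "subfield L ring_of_type_algebra" "range ratfun_const \<subseteq> L"
    "L \<subseteq> regular_function_field G" "\<And>g. g \<in> carrier G \<Longrightarrow> regular_action G g ` L \<subseteq> L"
    "faithful_action G L (\<lambda>g. restrict (regular_action G g) L)"
    using L unfolding faithful_intermediate_fields_def by blast+
  note inv = residue_field_invariant[OF G(1) _ L'(4)]
  define N where "N = {g \<in> carrier G. \<forall>s\<in>residue_field L. regular_action G g s = s}"
  have normal: "N \<lhd> G"
    using group_hom.normal_kernel[OF regular_action_restrict_hom[OF G(1) inv]]
    by (simp add: kernel_restricted_regular_action N_def)
  then have sub: "subgroup N G"
    by (rule normal_imp_subgroup)
  have finN: "finite N"
    using G(2) finite_subset[of N "carrier G"] by (simp add: N_def)
  have "\<one>\<^bsub>G\<^esub> \<in> N"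
    using sub by (rule subgroup.one_closed)
  have prime_divisor: "CHAR('k) = q" if q: "prime q" "q dvd card N" for q
  proof -
    have "\<exists>g\<in>carrier (G\<lparr>carrier := N\<rparr>). g \<noteq> \<one>\<^bsub>G\<lparr>carrier := N\<rparr>\<^esub> \<and>
        g [^]\<^bsub>G\<lparr>carrier := N\<rparr>\<^esub> q = \<one>\<^bsub>G\<lparr>carrier := N\<rparr>\<^esub>"
      using q finN
      by (intro exists_element_of_prime_order
          subgroup.subgroup_is_group[OF sub G(1)]) auto
    then obtain g where g: "g \<in> N" "g \<noteq> \<one>\<^bsub>G\<^esub>" "g [^]\<^bsub>G\<^esub> q = \<one>\<^bsub>G\<^esub>"
      by (auto simp: nat_pow_consistent[symmetric])
    then have gc: "g \<in> carrier G" "\<And>s. s \<in> residue_field L \<Longrightarrow> regular_action G g s = s"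
      by (auto simp: N_def)
    have "{g \<in> carrier G. \<forall>x\<in>L. regular_action G g x = x} = {\<one>\<^bsub>G\<^esub>}"
      using faithful_restricted_regular_action_iff[OF G(1) L'(4)] L'(5) by blast
    then obtain x where "x \<in> L" "regular_action G g x \<noteq> x"
      using g(2) gc(1) by blast
    then show ?thesis
      using char_eq_order_of_inertia_element[OF G(1) gc(1) q(1) g(3) L'(1,2) L'(4)[OF gc(1)] gc(2)] by blast
  qed
  have "N = {\<one>\<^bsub>G\<^esub>}"
  proof (rule ccontr)
    assume ne: "N \<noteq> {\<one>\<^bsub>G\<^esub>}"
    then have "card N \<noteq> 1"
      using \<open>\<one>\<^bsub>G\<^esub> \<in> N\<close> by (metis card_1_singletonE singletonD)
    then obtain p where p: "prime p" "p dvd card N"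
      using prime_factor_nat by blast
    have "card N > 0"
      using finN \<open>\<one>\<^bsub>G\<^esub> \<in> N\<close> by (auto simp: card_gt_0_iff)
    then have "\<exists>n. card N = p ^ n"
      using p prime_divisor by (intro eq_power_if_unique_prime_divisor) auto
    moreover have "weakly_tame p G"
      using G(3) prime_divisor[OF p] prime_gt_0_nat[OF p(1)] by simp
    ultimately show False
      using normal ne unfolding weakly_tame_def by blast
  qed
  then have "faithful_action G (residue_field L) (\<lambda>g. restrict (regular_action G g) (residue_field L))"
    using faithful_restricted_regular_action_iff[OF G(1) inv] by (simp add: N_def)
  moreover have "residue_field L \<subseteq> regular_function_field G"
    using reduction_in_regular_function_field L'(3) unfolding residue_field_def by blast
  ultimately show ?thesis
    using subfield_residue_field[OF L'(1)] consts_in_residue_field[OF L'(2)] inv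
    unfolding faithful_intermediate_fields_def by blast
qed

end

theorem theorem2p4:
  fixes R :: "'a::field set" and \<nu> :: "'a \<Rightarrow> int" and \<rho> :: "'a \<Rightarrow> 'k::field"
    and G :: "('g, 'm) monoid_scheme"
  assumes "dvr_with_residue_field R \<nu> \<rho>"
    and "group G" and "finite (carrier G)"
    and "CHAR('k) > 0 \<Longrightarrow> weakly_tame CHAR('k) G"
  shows "essential_dimension TYPE('a) G \<ge> essential_dimension TYPE('k) G"
proof -
  interpret dvr_with_residue_field R \<nu> \<rho> by fact
  show ?thesis
    unfolding essential_dimension_def
  proof (rule INF_greatest)
    fix L :: "('g, 'a) ratfun set"
    assume L: "L \<in> faithful_intermediate_fields G"
    have "residue_field L \<in> faithful_intermediate_fields G"
      by (rule residue_field_faithful[OF assms(2,3) _ L]) (rule assms(4))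
    then show "(INF L \<in> (faithful_intermediate_fields G :: ('g, 'k) ratfun set set).
        trdeg (ratfun_const :: 'k \<Rightarrow> ('g, 'k) ratfun) L) \<le> trdeg ratfun_const L"
      using trdeg_residue_field_le by (rule INF_lower2)
  qed
qed

end
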